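(* Let $P$ be an irreducible minuscule poset and let $k\in\mathbb{N}$ with $k\le\mathrm{width}(P)$. Then, with $\mathcal{A}_k(P)$ ordered by $\le_k$: (i) if $P\cong[a]\times[b]$, then $\mathcal{A}_k(P)\cong\mathcal{C}(a,k)\times\mathcal{C}(b,k)$; (ii) if $P\cong J([n]\times[2])$, then $\mathcal{A}_k(P)\cong\mathcal{A}_k(\mathcal{C}(n+2,2))\cong\mathcal{C}(n+2,2k)$; (iii) if $P\cong J^m([2]\times[2])$ with $m\in\mathbb{N}$, then $\mathcal{A}_k(P)$ is a singleton if $k\in\{0,2\}$ and $\mathcal{A}_k(P)\cong P$ if $k=1$; (iv) if $P\cong J^2([2]\times[3])$, then $\mathcal{A}_k(P)$ is a singleton if $k=0$, $\mathcal{A}_k(P)\cong P$ if $k=1$, and $\mathcal{A}_k(P)\cong J^3([2]\times[2])$ if $k=2$; (v) if $P\cong J^3([2]\times[3])$, then $\mathcal{A}_k(P)$ is a singleton if $k\in\{0,3\}$ and $\mathcal{A}_k(P)\cong P$ if $k\in\{1,2\}$; (vi) $\mathcal{A}_k(P)$ is a distributive lattice under $\le_k$.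
   Context: $[n]=\{1,\dots,n\}$ with its natural order; products of posets carry the product order. $J(Q)$ is the poset of order ideals of $Q$ under inclusion, $J^0(Q)=Q$ and $J^{m+1}(Q)=J(J^m(Q))$. The irreducible minuscule posets are exactly the posets isomorphic to one of $[a]\times[b]$, $J([n]\times[2])$, $J^m([2]\times[2])$, $J^2([2]\times[3])$, $J^3([2]\times[3])$, where $a,b,n\in\mathbb{Z}_+$ and $m\in\mathbb{N}$. $\mathrm{width}(P)$ is the maximum size of an antichain of $P$. $\mathcal{A}_k(P)$ is the set of antichains of $P$ of size $k$; for $A,B\in\mathcal{A}_k(P)$, $A\prec_k B$ means $A\setminus B=\{a\}$, $B\setminus A=\{b\}$ are singletons with $a<_P b$, and $\le_k$ is the reflexive transitive closure of $\prec_k$. For $k\le n$, $\mathcal{C}(n,k)$ is the set of $k$-element subsets of $[n]$ written as increasing sequences $(x_1<\dots<x_k)$, ordered by $\mathbf{x}\le\mathbf{y}$ iff $x_i\le y_i$ for all $i$. *)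

theory Defs
  imports Main "HOL-Library.FSet"
begin

record 'a poset =
  carrier :: "'a set"
  le :: "'a \<Rightarrow> 'a \<Rightarrow> bool"

definition is_poset :: "('a, 'b) poset_scheme \<Rightarrow> bool" where
  "is_poset P \<longleftrightarrow>
     (\<forall>x\<in>carrier P. le P x x) \<and>
     (\<forall>x\<in>carrier P. \<forall>y\<in>carrier P. le P x y \<and> le P y x \<longrightarrow> x = y) \<and>
     (\<forall>x\<in>carrier P. \<forall>y\<in>carrier P. \<forall>z\<in>carrier P. le P x y \<and> le P y z \<longrightarrow> le P x z)"

definition poset_iso :: "'a poset \<Rightarrow> 'b poset \<Rightarrow> bool" where
  "poset_iso P Q \<longleftrightarrow> (\<exists>f. bij_betw f (carrier P) (carrier Q) \<and>
      (\<forall>x\<in>carrier P. \<forall>y\<in>carrier P. le P x y \<longleftrightarrow> le Q (f x) (f y)))"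

definition is_singleton_poset :: "'a poset \<Rightarrow> bool" where
  "is_singleton_poset P \<longleftrightarrow> (\<exists>x. carrier P = {x})"

definition chain :: "nat \<Rightarrow> nat poset" where
  "chain n = \<lparr>carrier = {1..n}, le = (\<le>)\<rparr>"

definition prod_poset :: "'a poset \<Rightarrow> 'b poset \<Rightarrow> ('a \<times> 'b) poset" where
  "prod_poset P Q = \<lparr>carrier = carrier P \<times> carrier Q,
     le = (\<lambda>(a, b) (c, d). le P a c \<and> le Q b d)\<rparr>"

definition order_ideals :: "'a poset \<Rightarrow> 'a set set" where
  "order_ideals Q = {I. I \<subseteq> carrier Q \<and>
      (\<forall>x\<in>I. \<forall>y\<in>carrier Q. le Q y x \<longrightarrow> y \<in> I)}"

definition J :: "'a poset \<Rightarrow> 'a set poset" where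
  "J Q = \<lparr>carrier = order_ideals Q, le = (\<subseteq>)\<rparr>"

text \<open>Iterated J with a variable exponent m: since the element type of J^m(Q)
  depends on m, we encode all iterates in one universe of hereditarily finite sets
  over atoms of the base type. (All posets involved are finite.)\<close>
datatype 'a hf = Atom 'a | HSet "'a hf fset"

definition map_poset :: "('a \<Rightarrow> 'b) \<Rightarrow> 'a poset \<Rightarrow> 'b poset" where
  "map_poset f P = \<lparr>carrier = f ` carrier P,
     le = (\<lambda>x y. \<exists>a\<in>carrier P. \<exists>b\<in>carrier P. x = f a \<and> y = f b \<and> le P a b)\<rparr>"

definition J_hf :: "'a hf poset \<Rightarrow> 'a hf poset" where
  "J_hf Q = map_poset (\<lambda>I. HSet (Abs_fset I)) (J Q)"

definition Jpow :: "nat \<Rightarrow> 'a poset \<Rightarrow> 'a hf poset" where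
  "Jpow m Q = (J_hf ^^ m) (map_poset Atom Q)"

definition antichain :: "'a poset \<Rightarrow> 'a set \<Rightarrow> bool" where
  "antichain P A \<longleftrightarrow> A \<subseteq> carrier P \<and> (\<forall>x\<in>A. \<forall>y\<in>A. le P x y \<longrightarrow> x = y)"

definition width :: "'a poset \<Rightarrow> nat" where
  "width P = Max {card A | A. antichain P A \<and> finite A}"

definition antichains_k :: "'a poset \<Rightarrow> nat \<Rightarrow> 'a set set" where
  "antichains_k P k = {A. antichain P A \<and> finite A \<and> card A = k}"

definition kstep :: "'a poset \<Rightarrow> nat \<Rightarrow> 'a set \<Rightarrow> 'a set \<Rightarrow> bool" where
  "kstep P k A B \<longleftrightarrow> A \<in> antichains_k P k \<and> B \<in> antichains_k P k \<and>
     (\<exists>a b. A - B = {a} \<and> B - A = {b} \<and> le P a b \<and> a \<noteq> b)"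

definition Ak :: "'a poset \<Rightarrow> nat \<Rightarrow> 'a set poset" where
  "Ak P k = \<lparr>carrier = antichains_k P k, le = (kstep P k)\<^sup>*\<^sup>*\<rparr>"

definition Cnk :: "nat \<Rightarrow> nat \<Rightarrow> nat list poset" where
  "Cnk n k = \<lparr>carrier = {xs. sorted_wrt (<) xs \<and> length xs = k \<and> set xs \<subseteq> {1..n}},
     le = (\<lambda>xs ys. \<forall>i<k. xs ! i \<le> ys ! i)\<rparr>"

definition irreducible_minuscule :: "'a poset \<Rightarrow> bool" where
  "irreducible_minuscule P \<longleftrightarrow>
     (\<exists>a b. a > 0 \<and> b > 0 \<and> poset_iso P (prod_poset (chain a) (chain b))) \<or>
     (\<exists>n. n > 0 \<and> poset_iso P (J (prod_poset (chain n) (chain 2)))) \<or>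
     (\<exists>m. poset_iso P (Jpow m (prod_poset (chain 2) (chain 2)))) \<or>
     poset_iso P (J (J (prod_poset (chain 2) (chain 3)))) \<or>
     poset_iso P (J (J (J (prod_poset (chain 2) (chain 3)))))"

definition is_lub :: "'a poset \<Rightarrow> 'a \<Rightarrow> 'a \<Rightarrow> 'a \<Rightarrow> bool" where
  "is_lub P x y z \<longleftrightarrow> z \<in> carrier P \<and> le P x z \<and> le P y z \<and>
     (\<forall>w\<in>carrier P. le P x w \<and> le P y w \<longrightarrow> le P z w)"

definition is_glb :: "'a poset \<Rightarrow> 'a \<Rightarrow> 'a \<Rightarrow> 'a \<Rightarrow> bool" where
  "is_glb P x y z \<longleftrightarrow> z \<in> carrier P \<and> le P z x \<and> le P z y \<and>
     (\<forall>w\<in>carrier P. le P w x \<and> le P w y \<longrightarrow> le P w z)"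

definition join :: "'a poset \<Rightarrow> 'a \<Rightarrow> 'a \<Rightarrow> 'a" where
  "join P x y = (THE z. is_lub P x y z)"

definition meet :: "'a poset \<Rightarrow> 'a \<Rightarrow> 'a \<Rightarrow> 'a" where
  "meet P x y = (THE z. is_glb P x y z)"

definition is_lattice :: "'a poset \<Rightarrow> bool" where
  "is_lattice P \<longleftrightarrow> is_poset P \<and>
     (\<forall>x\<in>carrier P. \<forall>y\<in>carrier P. (\<exists>z. is_lub P x y z) \<and> (\<exists>z. is_glb P x y z))"

definition is_distributive_lattice :: "'a poset \<Rightarrow> bool" where
  "is_distributive_lattice P \<longleftrightarrow> is_lattice P \<and>
     (\<forall>x\<in>carrier P. \<forall>y\<in>carrier P. \<forall>z\<in>carrier P.
        meet P x (join P y z) = join P (meet P x y) (meet P x z))"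

end

theory Submission
  imports Defs "HOL-Library.Product_Order"
begin

text \<open>
  An isomorphism between \<open>\<A>\<^sub>k(P)\<close> and a finite poset \<open>Q\<close> is a bijection under which every elementary
  step \<open>\<prec>\<^sub>k\<close> goes up in \<open>Q\<close> and, whenever \<open>x < y\<close> in \<open>Q\<close>, some elementary step leads from \<open>x\<close>
  to an element below \<open>y\<close>. For a poset of pairs \<open>i < j\<close> with the product order, the
  antichains of size \<open>k\<close> are nested sequences \<open>i\<^sub>1 < \<dots> < i\<^sub>k < j\<^sub>k < \<dots> < j\<^sub>1\<close>, that is, increasing
  sequences of length \<open>2k\<close>. Both \<open>[a] \<times> [b]\<close> (after shifting the second coordinate by \<open>a\<close>) and
  \<open>J([n] \<times> [2])\<close> are of this form. The posets \<open>J\<^sup>m([2] \<times> [2])\<close> are chains with one diamond in the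
  middle, and \<open>J\<^sup>2([2] \<times> [3])\<close> and \<open>J\<^sup>3([2] \<times> [3])\<close> have 16 and 27 elements, so that the two conditions
  are checked there by evaluation. Distributivity is inherited from pointwise maxima and minima of
  sequences and from unions and intersections of order ideals.\<close>

section \<open>Poset isomorphisms\<close>

text \<open>The order on \<open>Ak P k\<close> is a transitive closure, so two antichains alone do
  not show whether they are comparable. Each isomorphism therefore passes through a target order in
  which comparison is explicit. All models are sets of pairs of naturals under the componentwise
  order. Listing an antichain there by increasing first coordinate forces the second coordinates to
  decrease, which is where the increasing sequences come from. For iterates of \<open>J\<close> the
  obstacle is the number of subsets: the ideals of the 16-element poset already lie among 65536
  sets. Ideals are never enumerated; a map giving the images of the principal ideals is tested on
  generators, symbolically for the families in \<open>n\<close> and \<open>m\<close> and by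
  evaluation for the two exceptional posets. In the exceptional posets only antichains of size two
  need a table: three pairwise incomparable elements do not occur among the 16 elements and occur in
  just one way among the 27.\<close>

lemma poset_isoI:
  assumes "bij_betw f (carrier P) (carrier Q)"
    and "\<And>x y. x \<in> carrier P \<Longrightarrow> y \<in> carrier P \<Longrightarrow> le P x y \<longleftrightarrow> le Q (f x) (f y)"
  shows "poset_iso P Q"
  unfolding poset_iso_def using assms by (intro exI[of _ f]) simp

lemma poset_iso_refl: "poset_iso P P"
  by (rule poset_isoI[of "\<lambda>x. x"]) (simp_all add: bij_betw_def)

lemma poset_iso_sym:
  assumes "poset_iso P Q" shows "poset_iso Q P"
proof -
  from assms obtain f where f: "bij_betw f (carrier P) (carrier Q)"
    and le: "\<forall>x\<in>carrier P. \<forall>y\<in>carrier P. le P x y \<longleftrightarrow> le Q (f x) (f y)"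
    unfolding poset_iso_def by (elim exE conjE)
  let ?g = "inv_into (carrier P) f"
  show ?thesis
  proof (rule poset_isoI[of ?g])
    show "bij_betw ?g (carrier Q) (carrier P)" using f by (rule bij_betw_inv_into)
    fix x y assume xy: "x \<in> carrier Q" "y \<in> carrier Q"
    then have "?g x \<in> carrier P" "?g y \<in> carrier P" "f (?g x) = x" "f (?g y) = y"
      using f by (simp_all add: bij_betw_def inv_into_into f_inv_into_f)
    then show "le Q x y \<longleftrightarrow> le P (?g x) (?g y)" using le by simp
  qed
qed

lemma poset_iso_trans:
  assumes "poset_iso P Q" "poset_iso Q R" shows "poset_iso P R"
proof -
  from assms(1) obtain f where f: "bij_betw f (carrier P) (carrier Q)"
    and le: "\<forall>x\<in>carrier P. \<forall>y\<in>carrier P. le P x y \<longleftrightarrow> le Q (f x) (f y)"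
    unfolding poset_iso_def by (elim exE conjE)
  from assms(2) obtain g where g: "bij_betw g (carrier Q) (carrier R)"
    and le': "\<forall>x\<in>carrier Q. \<forall>y\<in>carrier Q. le Q x y \<longleftrightarrow> le R (g x) (g y)"
    unfolding poset_iso_def by (elim exE conjE)
  show ?thesis
  proof (rule poset_isoI[of "g \<circ> f"])
    show "bij_betw (g \<circ> f) (carrier P) (carrier R)" using f g by (rule bij_betw_trans)
    fix x y assume xy: "x \<in> carrier P" "y \<in> carrier P"
    then have "f x \<in> carrier Q" "f y \<in> carrier Q" using f by (auto simp: bij_betw_def)
    then show "le P x y \<longleftrightarrow> le R ((g \<circ> f) x) ((g \<circ> f) y)" using le le' xy by simp
  qed
qed

lemma is_poset_reflD: "is_poset P \<Longrightarrow> x \<in> carrier P \<Longrightarrow> le P x x"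
  unfolding is_poset_def by simp

lemma is_poset_antisymD:
  "is_poset P \<Longrightarrow> le P x y \<Longrightarrow> le P y x \<Longrightarrow> x \<in> carrier P \<Longrightarrow> y \<in> carrier P \<Longrightarrow> x = y"
  unfolding is_poset_def by metis

lemma is_poset_transD:
  "is_poset P \<Longrightarrow> le P x y \<Longrightarrow> le P y z \<Longrightarrow> x \<in> carrier P \<Longrightarrow> y \<in> carrier P \<Longrightarrow> z \<in> carrier P
    \<Longrightarrow> le P x z"
  unfolding is_poset_def by metis

lemma is_poset_iso:
  assumes "poset_iso P Q" "is_poset Q" shows "is_poset P"
proof -
  from assms(1) obtain f where f: "bij_betw f (carrier P) (carrier Q)"
    and le: "\<forall>x\<in>carrier P. \<forall>y\<in>carrier P. le P x y \<longleftrightarrow> le Q (f x) (f y)"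
    unfolding poset_iso_def by (elim exE conjE)
  have fin: "f x \<in> carrier Q" if "x \<in> carrier P" for x using f that by (auto simp: bij_betw_def)
  have inj: "x = y" if "f x = f y" "x \<in> carrier P" "y \<in> carrier P" for x y
    using f that by (auto simp: bij_betw_def inj_on_def)
  show ?thesis
    unfolding is_poset_def
  proof (intro conjI ballI impI)
    fix x assume "x \<in> carrier P"
    then show "le P x x" using le fin assms(2) by (simp add: is_poset_reflD)
  next
    fix x y assume "x \<in> carrier P" "y \<in> carrier P" "le P x y \<and> le P y x"
    then show "x = y" using le fin inj[of x y] is_poset_antisymD[OF assms(2), of "f x" "f y"] by simp
  next
    fix x y z assume "x \<in> carrier P" "y \<in> carrier P" "z \<in> carrier P" "le P x y \<and> le P y z"
    then show "le P x z" using le fin is_poset_transD[OF assms(2), of "f x" "f y" "f z"] by simp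
  qed
qed

text \<open>Common form of all concrete models: the order axioms come from the type class, and on
  \<open>nat \<times> nat\<close> the order is the componentwise one, which simplification and
  evaluation can decide.\<close>

definition subposet :: "'a::order set \<Rightarrow> 'a poset" where
  "subposet S = \<lparr>carrier = S, le = (\<le>)\<rparr>"

lemma carrier_subposet [simp]: "carrier (subposet S) = S"
  and le_subposet [simp]: "le (subposet S) x y \<longleftrightarrow> x \<le> y"
  by (simp_all add: subposet_def)

lemma is_poset_subposet: "is_poset (subposet S)"
  unfolding is_poset_def by auto

text \<open>An order embedding is injective by antisymmetry, so only its image has to be
  computed.\<close>

lemma poset_iso_subposetI:
  assumes "\<And>x y. x \<in> carrier P \<Longrightarrow> y \<in> carrier P \<Longrightarrow> le P x y \<longleftrightarrow> f x \<le> f y"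
    and "is_poset P" and "f ` carrier P = S"
  shows "poset_iso P (subposet S)"
proof (rule poset_isoI[of f])
  have "inj_on f (carrier P)"
  proof (rule inj_onI)
    fix x y assume "x \<in> carrier P" "y \<in> carrier P" "f x = f y"
    then show "x = y" using assms(1)[of x y] assms(1)[of y x] assms(2) by (simp add: is_poset_antisymD)
  qed
  then show "bij_betw f (carrier P) (carrier (subposet S))" using assms(3) by (simp add: bij_betw_def)
qed (simp add: assms(1))

section \<open>Order ideals\<close>

lemma carrier_J [simp]: "carrier (J Q) = order_ideals Q"
  and le_J [simp]: "le (J Q) I K \<longleftrightarrow> I \<subseteq> K"
  by (simp_all add: J_def)

lemma is_poset_J: "is_poset (J Q)"
  unfolding is_poset_def by auto

lemma order_ideals_subset: "I \<in> order_ideals Q \<Longrightarrow> I \<subseteq> carrier Q"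
  by (simp add: order_ideals_def)

lemma order_idealsD:
  "I \<in> order_ideals Q \<Longrightarrow> x \<in> I \<Longrightarrow> y \<in> carrier Q \<Longrightarrow> le Q y x \<Longrightarrow> y \<in> I"
  by (simp add: order_ideals_def)

lemma finite_order_ideals: "finite (carrier Q) \<Longrightarrow> finite (order_ideals Q)"
  by (rule finite_subset[of _ "Pow (carrier Q)"]) (auto simp: order_ideals_def)

lemma image_order_ideals:
  assumes f: "bij_betw f (carrier P) (carrier Q)"
    and le: "\<And>x y. x \<in> carrier P \<Longrightarrow> y \<in> carrier P \<Longrightarrow> le P x y \<longleftrightarrow> le Q (f x) (f y)"
    and I: "I \<subseteq> carrier P"
  shows "f ` I \<in> order_ideals Q \<longleftrightarrow> I \<in> order_ideals P"
proof
  assume l: "f ` I \<in> order_ideals Q"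
  show "I \<in> order_ideals P" unfolding order_ideals_def
  proof (intro CollectI conjI ballI impI I)
    fix x y assume x: "x \<in> I" "y \<in> carrier P" "le P y x"
    then have "f y \<in> carrier Q" "le Q (f y) (f x)" "x \<in> carrier P"
      using f le I by (auto simp: bij_betw_def)
    then have "f y \<in> f ` I" using order_idealsD[OF l] x(1) by blast
    then show "y \<in> I" using f x(2) I by (auto simp: bij_betw_def inj_on_def)
  qed
next
  assume r: "I \<in> order_ideals P"
  show "f ` I \<in> order_ideals Q" unfolding order_ideals_def
  proof (intro CollectI conjI ballI impI)
    show "f ` I \<subseteq> carrier Q" using f I by (auto simp: bij_betw_def)
    fix x' y' assume x: "x' \<in> f ` I" "y' \<in> carrier Q" "le Q y' x'"
    moreover have "f ` carrier P = carrier Q" using f by (simp add: bij_betw_def)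
    ultimately obtain x y where xy: "x' = f x" "x \<in> I" "y' = f y" "y \<in> carrier P"
      by blast
    with le x(3) I have "le P y x" by auto
    then show "y' \<in> f ` I" using order_idealsD[OF r] xy by blast
  qed
qed

lemma J_cong:
  assumes "poset_iso P Q" shows "poset_iso (J P) (J Q)"
proof -
  from assms obtain f where f: "bij_betw f (carrier P) (carrier Q)"
    and le: "\<forall>x\<in>carrier P. \<forall>y\<in>carrier P. le P x y \<longleftrightarrow> le Q (f x) (f y)"
    unfolding poset_iso_def by (elim exE conjE)
  have inj: "inj_on f (carrier P)" using f by (simp add: bij_betw_def)
  have im: "bij_betw (image f) (Pow (carrier P)) (Pow (carrier Q))"
    using f by (rule bij_betw_Pow)
  show ?thesis
  proof (rule poset_isoI[of "image f"])
    show "bij_betw (image f) (carrier (J P)) (carrier (J Q))"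
      unfolding bij_betw_def carrier_J
    proof
      show "inj_on (image f) (order_ideals P)"
        by (rule inj_on_subset[of _ "Pow (carrier P)"])
          (use im in \<open>auto simp: bij_betw_def order_ideals_def\<close>)
      show "image f ` order_ideals P = order_ideals Q"
      proof (intro equalityI subsetI)
        fix K assume "K \<in> image f ` order_ideals P"
        then obtain I where "I \<in> order_ideals P" "K = f ` I" by blast
        then show "K \<in> order_ideals Q"
          using image_order_ideals[OF f le[rule_format] order_ideals_subset] by simp
      next
        fix K assume K: "K \<in> order_ideals Q"
        then have "K \<in> Pow (carrier Q)" using order_ideals_subset by blast
        then have "K \<in> image f ` Pow (carrier P)" using im by (simp add: bij_betw_def)
        then obtain I where I: "I \<subseteq> carrier P" "K = f ` I" by blast
        then have "I \<in> order_ideals P" using image_order_ideals[OF f le[rule_format] I(1)] K by simp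
        then show "K \<in> image f ` order_ideals P" using I by blast
      qed
    qed
    fix I K assume "I \<in> carrier (J P)" "K \<in> carrier (J P)"
    then have "I \<subseteq> carrier P" "K \<subseteq> carrier P" using order_ideals_subset by simp_all
    then have "f x \<in> f ` K \<longleftrightarrow> x \<in> K" if "x \<in> I" for x
      using that inj_on_image_mem_iff[OF inj, of x K] by blast
    then show "le (J P) I K \<longleftrightarrow> le (J Q) (f ` I) (f ` K)"
      by (simp add: image_subset_iff subset_eq)
  qed
qed

section \<open>Coding the iterates of \<open>J\<close> by hereditarily finite sets\<close>

lemma map_poset_iso:
  assumes "inj_on f (carrier P)" shows "poset_iso P (map_poset f P)"
proof (rule poset_isoI[of f])
  show "bij_betw f (carrier P) (carrier (map_poset f P))"
    using assms by (simp add: bij_betw_def map_poset_def)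
  fix x y assume "x \<in> carrier P" "y \<in> carrier P"
  then show "le P x y \<longleftrightarrow> le (map_poset f P) (f x) (f y)"
    using assms by (auto simp: map_poset_def inj_on_eq_iff)
qed

lemma finite_carrier_Jpow: "finite (carrier Q) \<Longrightarrow> finite (carrier (Jpow m Q))"
  by (induction m) (simp_all add: Jpow_def J_hf_def map_poset_def finite_order_ideals)

lemma Jpow_0: "poset_iso Q (Jpow 0 Q)"
  unfolding Jpow_def by (simp add: map_poset_iso inj_on_def)

text \<open>Finiteness of the base makes every ideal finite, and on finite sets
  \<open>Abs_fset\<close> is injective, so the coding loses nothing.\<close>

lemma Jpow_Suc:
  assumes "finite (carrier Q)"
  shows "poset_iso (J (Jpow m Q)) (Jpow (Suc m) Q)"
proof -
  have fin: "finite (carrier (Jpow m Q))" using assms by (rule finite_carrier_Jpow)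
  have "inj_on (\<lambda>I. HSet (Abs_fset I)) (carrier (J (Jpow m Q)))"
  proof (rule inj_onI)
    fix I K assume IK: "I \<in> carrier (J (Jpow m Q))" "K \<in> carrier (J (Jpow m Q))"
      "HSet (Abs_fset I) = HSet (Abs_fset K)"
    have "finite I" "finite K"
      using IK(1,2) fin order_ideals_subset finite_subset by (metis carrier_J)+
    then show "I = K" using IK(3) Abs_fset_inject by auto
  qed
  from map_poset_iso[OF this] show ?thesis by (simp add: Jpow_def J_hf_def)
qed

text \<open>The finite Birkhoff representation in a form that only needs to be tested on generators:
  \<^term>\<open>\<phi> q\<close> is the join-irreducible element of \<^term>\<open>S\<close> that corresponds to the principal
  ideal of \<^term>\<open>q\<close>, and \<open>step\<close> says that a minimal element outside an ideal can be added to it.\<close>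

lemma J_iso_subposet:
  fixes S :: "'b::order set"
  assumes Q: "is_poset Q" and fin: "finite (carrier Q)"
    and emb: "\<And>s t. s \<in> S \<Longrightarrow> t \<in> S \<Longrightarrow> (\<And>q. q \<in> carrier Q \<Longrightarrow> \<phi> q \<le> s \<Longrightarrow> \<phi> q \<le> t) \<Longrightarrow> s \<le> t"
    and mono: "\<And>p q. p \<in> carrier Q \<Longrightarrow> q \<in> carrier Q \<Longrightarrow> le Q p q \<Longrightarrow> \<phi> p \<le> \<phi> q"
    and bot: "\<exists>s\<in>S. \<forall>q\<in>carrier Q. \<not> \<phi> q \<le> s"
    and step: "\<And>s q. s \<in> S \<Longrightarrow> q \<in> carrier Q \<Longrightarrow> \<not> \<phi> q \<le> s \<Longrightarrow>
      (\<And>p. p \<in> carrier Q \<Longrightarrow> le Q p q \<Longrightarrow> p \<noteq> q \<Longrightarrow> \<phi> p \<le> s) \<Longrightarrow>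
      \<exists>t\<in>S. \<forall>p\<in>carrier Q. \<phi> p \<le> t \<longleftrightarrow> \<phi> p \<le> s \<or> p = q"
  shows "poset_iso (J Q) (subposet S)"
proof -
  \<comment> \<open>Birkhoff's map: \<open>g s\<close> collects the generators whose images lie
    below \<open>s\<close>.\<close>
  define g where "g s = {q \<in> carrier Q. \<phi> q \<le> s}" for s
  have g_le: "g s \<subseteq> g t \<longleftrightarrow> s \<le> t" if "s \<in> S" "t \<in> S" for s t
  proof
    assume "g s \<subseteq> g t"
    then show "s \<le> t" using emb[OF that] by (auto simp: g_def)
  next
    assume "s \<le> t"
    then show "g s \<subseteq> g t" by (auto simp: g_def intro: order.trans)
  qed
  have g_ideal: "g s \<in> order_ideals Q" for s
    unfolding order_ideals_def g_def using mono by (auto intro: order.trans)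
  \<comment> \<open>Induction on the size of the ideal: without a maximal element \<open>q\<close>
    it is still an ideal, hence some \<open>g s\<close>, and \<open>step\<close> puts
    \<open>q\<close> back.\<close>
  have surj: "\<exists>s\<in>S. g s = I" if "I \<in> order_ideals Q" for I
    using that
  proof (induction "card I" arbitrary: I)
    case 0
    then have "I = {}" using fin order_ideals_subset finite_subset by (metis card_eq_0_iff)
    then show ?case using bot by (auto simp: g_def)
  next
    case (Suc n)
    have sub: "I \<subseteq> carrier Q" using Suc.prems by (rule order_ideals_subset)
    then have finI: "finite I" using fin by (rule finite_subset)
    have "\<exists>q\<in>I. \<forall>p\<in>I. le Q q p \<longrightarrow> p = q"
    proof -
      let ?R = "\<lambda>x y. le Q x y \<and> x \<noteq> y"
      have "I \<noteq> {}" using Suc.hyps(2) by auto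
      moreover have "asymp_on I ?R"
      proof (rule asymp_onI)
        fix x y assume "x \<in> I" "y \<in> I" "?R x y"
        then show "\<not> ?R y x" using is_poset_antisymD[OF Q, of x y] sub by blast
      qed
      moreover have "transp_on I ?R"
      proof (rule transp_onI)
        fix x y z assume "x \<in> I" "y \<in> I" "z \<in> I" "?R x y" "?R y z"
        then show "?R x z"
          using is_poset_transD[OF Q, of x y z] is_poset_antisymD[OF Q, of x y] sub by blast
      qed
      ultimately obtain q where "q \<in> I" "\<forall>p\<in>I. p \<noteq> q \<longrightarrow> \<not> ?R q p"
        using Finite_Set.bex_max_element[OF finI, of ?R] by blast
      then show ?thesis by (intro bexI[of _ q]) auto
    qed
    then obtain q where q: "q \<in> I" and max: "\<And>p. p \<in> I \<Longrightarrow> le Q q p \<Longrightarrow> p = q" by blast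
    have "I - {q} \<in> order_ideals Q"
      unfolding order_ideals_def using order_idealsD[OF Suc.prems] sub max by blast
    moreover have "n = card (I - {q})" using Suc.hyps(2) finI q by simp
    ultimately obtain s where s: "s \<in> S" "g s = I - {q}" using Suc.hyps(1) by blast
    have "\<exists>t\<in>S. \<forall>p\<in>carrier Q. \<phi> p \<le> t \<longleftrightarrow> \<phi> p \<le> s \<or> p = q"
    proof (rule step)
      show "s \<in> S" by fact
      show "q \<in> carrier Q" using q sub by blast
      then show "\<not> \<phi> q \<le> s" using s(2) by (auto simp: g_def)
      fix p assume p: "p \<in> carrier Q" "le Q p q" "p \<noteq> q"
      then have "p \<in> g s" using order_idealsD[OF Suc.prems q] s(2) by simp
      then show "\<phi> p \<le> s" by (simp add: g_def)
    qed
    then obtain t where t: "t \<in> S" "\<forall>p\<in>carrier Q. \<phi> p \<le> t \<longleftrightarrow> \<phi> p \<le> s \<or> p = q" by blast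
    then have "g t = insert q (g s)" using q sub by (auto simp: g_def)
    then have "g t = I" using s(2) q by auto
    then show ?case using t(1) by blast
  qed
  have "poset_iso (subposet S) (J Q)"
  proof (rule poset_isoI[of g])
    have "inj_on g S"
      by (rule inj_onI) (use g_le in \<open>metis order.antisym subset_refl\<close>)
    moreover have "g ` S = order_ideals Q"
    proof (intro equalityI subsetI)
      fix I assume "I \<in> order_ideals Q"
      then show "I \<in> g ` S" using surj by blast
    qed (use g_ideal in blast)
    ultimately show "bij_betw g (carrier (subposet S)) (carrier (J Q))"
      by (simp add: bij_betw_def)
  qed (simp add: g_le)
  then show ?thesis by (rule poset_iso_sym)
qed

section \<open>Antichains\<close>

lemma carrier_Ak [simp]: "carrier (Ak P k) = antichains_k P k"
  and le_Ak [simp]: "le (Ak P k) = (kstep P k)\<^sup>*\<^sup>*"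
  by (simp_all add: Ak_def)

lemma antichains_k_subset: "A \<in> antichains_k P k \<Longrightarrow> A \<subseteq> carrier P"
  by (simp add: antichains_k_def antichain_def)

lemma image_antichains_k:
  assumes f: "bij_betw f (carrier P) (carrier Q)"
    and le: "\<forall>x\<in>carrier P. \<forall>y\<in>carrier P. le P x y \<longleftrightarrow> le Q (f x) (f y)"
    and A: "A \<subseteq> carrier P"
  shows "f ` A \<in> antichains_k Q k \<longleftrightarrow> A \<in> antichains_k P k"
proof -
  have inj: "inj_on f A" using f A inj_on_subset[of f "carrier P" A] by (simp add: bij_betw_def)
  have sub: "f ` A \<subseteq> carrier Q" using f A by (auto simp: bij_betw_def)
  have "le Q (f x) (f y) \<longleftrightarrow> le P x y" "f x = f y \<longleftrightarrow> x = y" if "x \<in> A" "y \<in> A" for x y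
    using le A that inj by (auto simp: inj_on_eq_iff)
  then show ?thesis
    using inj sub A by (simp add: antichains_k_def antichain_def finite_image_iff card_image)
qed

lemma kstep_image:
  assumes f: "bij_betw f (carrier P) (carrier Q)"
    and le: "\<forall>x\<in>carrier P. \<forall>y\<in>carrier P. le P x y \<longleftrightarrow> le Q (f x) (f y)"
    and step: "kstep P k A B"
  shows "kstep Q k (f ` A) (f ` B)"
proof -
  from step obtain a b where AB: "A \<in> antichains_k P k" "B \<in> antichains_k P k"
    "A - B = {a}" "B - A = {b}" "le P a b" "a \<noteq> b"
    unfolding kstep_def by (elim conjE exE)
  have sub: "A \<subseteq> carrier P" "B \<subseteq> carrier P" using AB(1,2) antichains_k_subset by blast+
  then have inj: "inj_on f (A \<union> B)"
    using f inj_on_subset[of f "carrier P" "A \<union> B"] by (simp add: bij_betw_def)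
  have ab: "a \<in> carrier P" "b \<in> carrier P" using AB(3,4) sub by blast+
  have "f ` A - f ` B = f ` (A - B)" "f ` B - f ` A = f ` (B - A)"
    using inj by (metis inj_on_image_set_diff Diff_subset Un_upper1 Un_upper2 sup.coboundedI1 sup.coboundedI2)+
  then have "f ` A - f ` B = {f a}" "f ` B - f ` A = {f b}" unfolding AB(3,4) by simp_all
  moreover have "le Q (f a) (f b)" using le ab AB(5) by simp
  moreover have "f a \<noteq> f b" using ab AB(6) f by (auto simp: bij_betw_def inj_on_eq_iff)
  moreover have "f ` A \<in> antichains_k Q k" "f ` B \<in> antichains_k Q k"
    using image_antichains_k[OF f le sub(1)] image_antichains_k[OF f le sub(2)] AB(1,2) by simp_all
  ultimately show ?thesis unfolding kstep_def by (intro conjI exI[of _ "f a"] exI[of _ "f b"])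
qed

lemma rtranclp_kstep_image:
  assumes f: "bij_betw f (carrier P) (carrier Q)"
    and le: "\<forall>x\<in>carrier P. \<forall>y\<in>carrier P. le P x y \<longleftrightarrow> le Q (f x) (f y)"
    and "(kstep P k)\<^sup>*\<^sup>* A B"
  shows "(kstep Q k)\<^sup>*\<^sup>* (f ` A) (f ` B)"
  using assms(3)
proof (induction rule: rtranclp_induct)
  case (step B C)
  then show ?case using kstep_image[OF f le] by (metis rtranclp.rtrancl_into_rtrancl)
qed simp

lemma Ak_cong:
  assumes "poset_iso P Q" shows "poset_iso (Ak P k) (Ak Q k)"
proof -
  from assms obtain f where f: "bij_betw f (carrier P) (carrier Q)"
    and le: "\<forall>x\<in>carrier P. \<forall>y\<in>carrier P. le P x y \<longleftrightarrow> le Q (f x) (f y)"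
    unfolding poset_iso_def by (elim exE conjE)
  define g where "g = inv_into (carrier P) f"
  have g: "bij_betw g (carrier Q) (carrier P)" unfolding g_def using f by (rule bij_betw_inv_into)
  have gf: "g (f x) = x" if "x \<in> carrier P" for x
    using f that by (simp add: g_def bij_betw_inv_into_left)
  have le': "\<forall>x\<in>carrier Q. \<forall>y\<in>carrier Q. le Q x y \<longleftrightarrow> le P (g x) (g y)"
  proof (intro ballI)
    fix x y assume "x \<in> carrier Q" "y \<in> carrier Q"
    moreover from this have "g x \<in> carrier P" "g y \<in> carrier P" using g by (auto simp: bij_betw_def)
    ultimately show "le Q x y \<longleftrightarrow> le P (g x) (g y)"
      using le f by (simp add: g_def bij_betw_inv_into_right)
  qed
  have gf': "g ` f ` A = A" if "A \<subseteq> carrier P" for A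
    using that gf by (force simp: image_image)
  have im: "bij_betw (image f) (Pow (carrier P)) (Pow (carrier Q))"
    using f by (rule bij_betw_Pow)
  show ?thesis
  proof (rule poset_isoI[of "image f"])
    show "bij_betw (image f) (carrier (Ak P k)) (carrier (Ak Q k))"
      unfolding bij_betw_def carrier_Ak
    proof
      show "inj_on (image f) (antichains_k P k)"
        by (rule inj_on_inverseI[of _ "image g"]) (simp add: gf' antichains_k_subset)
      show "image f ` antichains_k P k = antichains_k Q k"
      proof (intro equalityI subsetI)
        fix K assume "K \<in> image f ` antichains_k P k"
        then obtain I where "I \<in> antichains_k P k" "K = f ` I" by blast
        then show "K \<in> antichains_k Q k"
          using image_antichains_k[OF f le antichains_k_subset] by simp
      next
        fix K assume K: "K \<in> antichains_k Q k"
        then have "K \<in> Pow (carrier Q)" using antichains_k_subset by blast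
        then have "K \<in> image f ` Pow (carrier P)" using im by (simp add: bij_betw_def)
        then obtain I where I: "I \<subseteq> carrier P" "K = f ` I" by blast
        then have "I \<in> antichains_k P k" using image_antichains_k[OF f le I(1)] K by simp
        then show "K \<in> image f ` antichains_k P k" using I by blast
      qed
    qed
    fix A B assume "A \<in> carrier (Ak P k)" "B \<in> carrier (Ak P k)"
    then have "A \<subseteq> carrier P" "B \<subseteq> carrier P" by (simp_all add: antichains_k_subset)
    then show "le (Ak P k) A B \<longleftrightarrow> le (Ak Q k) (f ` A) (f ` B)"
      using rtranclp_kstep_image[OF f le, of k A B] rtranclp_kstep_image[OF g le', of k "f ` A" "f ` B"]
        gf' by auto
  qed
qed

text \<open>Composing steps turns \<open>mono\<close> into order preservation. Conversely, each use
  of \<open>progress\<close> moves \<open>x\<close> strictly up towards \<open>y\<close>, so the set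
  of elements above \<open>x\<close> shrinks; as \<open>Q\<close> is finite, a chain of steps
  reaches \<open>y\<close>.\<close>

lemma Ak_isoI:
  assumes Q: "is_poset Q" and fin: "finite (carrier Q)"
    and g: "bij_betw g (carrier Q) (antichains_k P k)"
    and mono: "\<And>x y. x \<in> carrier Q \<Longrightarrow> y \<in> carrier Q \<Longrightarrow> kstep P k (g x) (g y) \<Longrightarrow> le Q x y"
    and progress: "\<And>x y. x \<in> carrier Q \<Longrightarrow> y \<in> carrier Q \<Longrightarrow> le Q x y \<Longrightarrow> x \<noteq> y \<Longrightarrow>
      \<exists>z\<in>carrier Q. kstep P k (g x) (g z) \<and> le Q z y"
  shows "poset_iso (Ak P k) Q"
proof -
  have g_in: "g x \<in> antichains_k P k" if "x \<in> carrier Q" for x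
    using g that by (auto simp: bij_betw_def)
  have g_inj: "x = y" if "g x = g y" "x \<in> carrier Q" "y \<in> carrier Q" for x y
    using g that by (auto simp: bij_betw_def inj_on_def)
  have mono': "le Q x y" if "(kstep P k)\<^sup>*\<^sup>* (g x) B" "B = g y" "x \<in> carrier Q" "y \<in> carrier Q" for x y B
    using that
  proof (induction arbitrary: y rule: rtranclp_induct)
    case base
    then have "x = y" by (intro g_inj)
    then show ?case using Q base(2) by (simp add: is_poset_reflD)
  next
    case (step B C)
    have "B \<in> antichains_k P k" using step.hyps(2) by (simp add: kstep_def)
    then obtain z where z: "z \<in> carrier Q" "B = g z" using g by (auto simp: bij_betw_def)
    have "le Q x z" using step.IH[OF z(2) step.prems(2) z(1)] .
    moreover have "le Q z y" using mono[of z y] step.hyps(2) z step.prems by simp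
    ultimately show ?case using is_poset_transD[OF Q, of x z y] z(1) step.prems(2,3) by simp
  qed
  have prog': "(kstep P k)\<^sup>*\<^sup>* (g x) (g y)" if "le Q x y" "x \<in> carrier Q" "y \<in> carrier Q" for x y
    using that
  proof (induction "card {z \<in> carrier Q. le Q x z}" arbitrary: x rule: less_induct)
    case less
    show ?case
    proof (cases "x = y")
      case False
      from progress[OF less.prems(2,3,1) False] obtain z
        where z: "z \<in> carrier Q" "kstep P k (g x) (g z)" "le Q z y" by blast
      have xz: "le Q x z" using mono less.prems(2) z(1,2) by simp
      have "x \<noteq> z" using z(2) by (auto simp: kstep_def)
      have "{w \<in> carrier Q. le Q z w} \<subset> {w \<in> carrier Q. le Q x w}"
      proof
        show "{w \<in> carrier Q. le Q z w} \<subseteq> {w \<in> carrier Q. le Q x w}"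
        proof (intro subsetI CollectI, elim CollectE conjE, intro conjI)
          fix w assume "w \<in> carrier Q" "le Q z w"
          then show "le Q x w" using is_poset_transD[OF Q xz, of w] less.prems(2) z(1) by simp
        qed
        have "x \<notin> {w \<in> carrier Q. le Q z w}"
          using is_poset_antisymD[OF Q xz] \<open>x \<noteq> z\<close> z(1) less.prems(2) by auto
        moreover have "x \<in> {w \<in> carrier Q. le Q x w}"
          using Q less.prems(2) by (simp add: is_poset_reflD)
        ultimately show "{w \<in> carrier Q. le Q z w} \<noteq> {w \<in> carrier Q. le Q x w}" by metis
      qed
      then have "card {w \<in> carrier Q. le Q z w} < card {w \<in> carrier Q. le Q x w}"
        using fin by (intro psubset_card_mono) simp_all
      from less.hyps[OF this z(3,1) less.prems(3)] z(2) show ?thesis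
        by (rule converse_rtranclp_into_rtranclp[rotated])
    qed simp
  qed
  have "poset_iso Q (Ak P k)"
  proof (rule poset_isoI[of g])
    fix x y assume "x \<in> carrier Q" "y \<in> carrier Q"
    then show "le Q x y \<longleftrightarrow> le (Ak P k) (g x) (g y)"
      using mono'[OF _ refl, of x y] prog'[of x y] by auto
  qed (simp add: g)
  then show ?thesis by (rule poset_iso_sym)
qed

lemma antichains_k_0: "antichains_k P 0 = {{}}"
  by (auto simp: antichains_k_def antichain_def)

lemma is_singleton_poset_Ak_0: "is_singleton_poset (Ak P 0)"
  by (simp add: is_singleton_poset_def antichains_k_0)

text \<open>For singletons any strict comparison is already one elementary step, so
  \<open>progress\<close> can jump to the target at once.\<close>

lemma Ak_1_iso:
  assumes P: "is_poset P" and fin: "finite (carrier P)"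
  shows "poset_iso (Ak P 1) P"
proof (rule Ak_isoI[OF P fin, where g = "\<lambda>x. {x}"])
  have 1: "antichains_k P 1 = (\<lambda>x. {x}) ` carrier P"
    by (auto simp: antichains_k_def antichain_def card_1_singleton_iff)
  show "bij_betw (\<lambda>x. {x}) (carrier P) (antichains_k P 1)"
    unfolding 1 by (simp add: bij_betw_def inj_on_def)
  show "le P x y" if "kstep P 1 {x} {y}" for x y
  proof -
    from that obtain a b where "{x} - {y} = {a}" "{y} - {x} = {b}" "le P a b" "a \<noteq> b"
      unfolding kstep_def by (elim conjE exE)
    moreover from this(1,2) have "a = x" "b = y" by blast+
    ultimately show ?thesis by simp
  qed
  show "\<exists>z\<in>carrier P. kstep P 1 {x} {z} \<and> le P z y"
    if "x \<in> carrier P" "y \<in> carrier P" "le P x y" "x \<noteq> y" for x y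
  proof (intro bexI[of _ y] conjI)
    show "kstep P 1 {x} {y}"
      unfolding kstep_def 1 using that by (intro conjI imageI exI[of _ x] exI[of _ y]) auto
  qed (use that P in \<open>simp_all add: is_poset_reflD\<close>)
qed

section \<open>Distributive lattices\<close>

lemma is_lub_unique:
  "is_poset P \<Longrightarrow> is_lub P x y z \<Longrightarrow> is_lub P x y w \<Longrightarrow> z = w"
  unfolding is_lub_def by (elim conjE, rule is_poset_antisymD[of P]) simp_all

lemma is_glb_unique:
  "is_poset P \<Longrightarrow> is_glb P x y z \<Longrightarrow> is_glb P x y w \<Longrightarrow> z = w"
  unfolding is_glb_def by (elim conjE, rule is_poset_antisymD[of P]) simp_all

lemma join_eqI: "is_poset P \<Longrightarrow> is_lub P x y z \<Longrightarrow> join P x y = z"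
  unfolding join_def by (rule the_equality) (simp_all add: is_lub_unique)

lemma meet_eqI: "is_poset P \<Longrightarrow> is_glb P x y z \<Longrightarrow> meet P x y = z"
  unfolding meet_def by (rule the_equality) (simp_all add: is_glb_unique)

text \<open>A sublattice of a distributive lattice is distributive. The ambient lattice is a type:
  functions into \<open>nat\<close> for sequences, sets for order ideals.\<close>

lemma is_distributive_lattice_embed:
  fixes f :: "'a \<Rightarrow> 'b::distrib_lattice"
  assumes P: "is_poset P"
    and le: "\<And>x y. x \<in> carrier P \<Longrightarrow> y \<in> carrier P \<Longrightarrow> le P x y \<longleftrightarrow> f x \<le> f y"
    and sup: "\<And>x y. x \<in> carrier P \<Longrightarrow> y \<in> carrier P \<Longrightarrow> sup (f x) (f y) \<in> f ` carrier P"
    and inf: "\<And>x y. x \<in> carrier P \<Longrightarrow> y \<in> carrier P \<Longrightarrow> inf (f x) (f y) \<in> f ` carrier P"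
  shows "is_distributive_lattice P"
proof -
  define s where "s x y = (SOME z. z \<in> carrier P \<and> f z = sup (f x) (f y))" for x y
  define i where "i x y = (SOME z. z \<in> carrier P \<and> f z = inf (f x) (f y))" for x y
  have s: "s x y \<in> carrier P \<and> f (s x y) = sup (f x) (f y)"
    if xy: "x \<in> carrier P" "y \<in> carrier P" for x y
  proof -
    have "\<exists>z. z \<in> carrier P \<and> f z = sup (f x) (f y)" using sup[OF xy] by force
    then show ?thesis unfolding s_def by (rule someI_ex)
  qed
  have i: "i x y \<in> carrier P \<and> f (i x y) = inf (f x) (f y)"
    if xy: "x \<in> carrier P" "y \<in> carrier P" for x y
  proof -
    have "\<exists>z. z \<in> carrier P \<and> f z = inf (f x) (f y)" using inf[OF xy] by force
    then show ?thesis unfolding i_def by (rule someI_ex)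
  qed
  have lub: "is_lub P x y (s x y)" if "x \<in> carrier P" "y \<in> carrier P" for x y
    unfolding is_lub_def using s[OF that] that by (simp add: le)
  have glb: "is_glb P x y (i x y)" if "x \<in> carrier P" "y \<in> carrier P" for x y
    unfolding is_glb_def using i[OF that] that by (simp add: le)
  have inj: "x = y" if "f x = f y" "x \<in> carrier P" "y \<in> carrier P" for x y
    using that le[of x y] le[of y x] by (intro is_poset_antisymD[OF P]) simp_all
  have join: "join P x y = s x y" if "x \<in> carrier P" "y \<in> carrier P" for x y
    using P lub[OF that] by (rule join_eqI)
  have meet: "meet P x y = i x y" if "x \<in> carrier P" "y \<in> carrier P" for x y
    using P glb[OF that] by (rule meet_eqI)
  have "meet P x (join P y z) = join P (meet P x y) (meet P x z)"
    if xyz: "x \<in> carrier P" "y \<in> carrier P" "z \<in> carrier P" for x y z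
  proof -
    have "i x (s y z) = s (i x y) (i x z)"
      using xyz s i by (intro inj) (simp_all add: inf_sup_distrib1)
    then show ?thesis using xyz s i join meet by simp
  qed
  then show ?thesis unfolding is_distributive_lattice_def is_lattice_def using P lub glb by blast
qed

text \<open>\<open>join\<close> and \<open>meet\<close> are definite descriptions, so they commute
  with \<open>f\<close> only after the bounds existing in \<open>Q\<close> have been pulled back to
  \<open>P\<close>.\<close>

lemma is_distributive_lattice_iso:
  assumes iso: "poset_iso P Q" and Q: "is_distributive_lattice Q"
  shows "is_distributive_lattice P"
proof -
  have pQ: "is_poset Q" using Q by (simp add: is_distributive_lattice_def is_lattice_def)
  have pP: "is_poset P" using iso pQ by (rule is_poset_iso)
  from iso obtain f where f: "bij_betw f (carrier P) (carrier Q)"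
    and le: "\<forall>x\<in>carrier P. \<forall>y\<in>carrier P. le P x y \<longleftrightarrow> le Q (f x) (f y)"
    unfolding poset_iso_def by (elim exE conjE)
  have f_in: "f x \<in> carrier Q" if "x \<in> carrier P" for x using f that by (auto simp: bij_betw_def)
  have surj: "\<exists>x\<in>carrier P. y = f x" if "y \<in> carrier Q" for y
    using f that by (auto simp: bij_betw_def)
  have ball: "(\<forall>w\<in>carrier Q. R w) \<longleftrightarrow> (\<forall>w\<in>carrier P. R (f w))" for R
    using surj f_in by metis
  have lub: "is_lub P x y z \<longleftrightarrow> is_lub Q (f x) (f y) (f z)"
    if "x \<in> carrier P" "y \<in> carrier P" "z \<in> carrier P" for x y z
    unfolding is_lub_def ball using le f_in that by simp
  have glb: "is_glb P x y z \<longleftrightarrow> is_glb Q (f x) (f y) (f z)"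
    if "x \<in> carrier P" "y \<in> carrier P" "z \<in> carrier P" for x y z
    unfolding is_glb_def ball using le f_in that by simp
  have ex_lub: "\<exists>z\<in>carrier P. is_lub P x y z \<and> join P x y = z \<and> join Q (f x) (f y) = f z"
    if xy: "x \<in> carrier P" "y \<in> carrier P" for x y
  proof -
    obtain w where w: "is_lub Q (f x) (f y) w"
      using Q f_in[OF xy(1)] f_in[OF xy(2)] unfolding is_distributive_lattice_def is_lattice_def by blast
    then obtain z where z: "z \<in> carrier P" "w = f z" using surj by (auto simp: is_lub_def)
    then have "is_lub P x y z" using lub xy w by simp
    then show ?thesis using z join_eqI[OF pP] join_eqI[OF pQ] w by (intro bexI[of _ z]) auto
  qed
  have ex_glb: "\<exists>z\<in>carrier P. is_glb P x y z \<and> meet P x y = z \<and> meet Q (f x) (f y) = f z"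
    if xy: "x \<in> carrier P" "y \<in> carrier P" for x y
  proof -
    obtain w where w: "is_glb Q (f x) (f y) w"
      using Q f_in[OF xy(1)] f_in[OF xy(2)] unfolding is_distributive_lattice_def is_lattice_def by blast
    then obtain z where z: "z \<in> carrier P" "w = f z" using surj by (auto simp: is_glb_def)
    then have "is_glb P x y z" using glb xy w by simp
    then show ?thesis using z meet_eqI[OF pP] meet_eqI[OF pQ] w by (intro bexI[of _ z]) auto
  qed
  have join: "join P x y \<in> carrier P" "f (join P x y) = join Q (f x) (f y)"
    if "x \<in> carrier P" "y \<in> carrier P" for x y
    using ex_lub[OF that] by auto
  have meet: "meet P x y \<in> carrier P" "f (meet P x y) = meet Q (f x) (f y)"
    if "x \<in> carrier P" "y \<in> carrier P" for x y
    using ex_glb[OF that] by auto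
  have "meet P x (join P y z) = join P (meet P x y) (meet P x z)"
    if xyz: "x \<in> carrier P" "y \<in> carrier P" "z \<in> carrier P" for x y z
  proof -
    have "meet Q (f x) (join Q (f y) (f z)) = join Q (meet Q (f x) (f y)) (meet Q (f x) (f z))"
      using Q f_in xyz by (simp add: is_distributive_lattice_def)
    then have eq: "f (meet P x (join P y z)) = f (join P (meet P x y) (meet P x z))"
      using xyz join meet by simp
    have "inj_on f (carrier P)" using f by (simp add: bij_betw_def)
    then show ?thesis using eq by (rule inj_onD[where f = f]) (use xyz join meet in simp_all)
  qed
  moreover have "\<exists>z. is_lub P x y z" "\<exists>z. is_glb P x y z"
    if "x \<in> carrier P" "y \<in> carrier P" for x y
    using ex_lub[OF that] ex_glb[OF that] by (elim bexE, blast)+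
  ultimately show ?thesis
    unfolding is_distributive_lattice_def is_lattice_def by (simp add: pP)
qed

lemma is_distributive_lattice_empty:
  "carrier P = {} \<Longrightarrow> is_distributive_lattice P"
  by (simp add: is_distributive_lattice_def is_lattice_def is_poset_def)

lemma is_distributive_lattice_Ak_singleton:
  assumes "is_singleton_poset (Ak P k)" shows "is_distributive_lattice (Ak P k)"
proof -
  from assms obtain A where A: "carrier (Ak P k) = {A}" unfolding is_singleton_poset_def ..
  have "is_poset (Ak P k)" unfolding is_poset_def A by simp
  then show ?thesis
    by (rule is_distributive_lattice_embed[where f = "\<lambda>_. 0::nat"]) (use A in auto)
qed

lemma is_distributive_lattice_J: "is_distributive_lattice (J Q)"
proof (rule is_distributive_lattice_embed[OF is_poset_J, where f = "\<lambda>I. I"])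
  fix I K assume "I \<in> carrier (J Q)" "K \<in> carrier (J Q)"
  then show "sup I K \<in> (\<lambda>I. I) ` carrier (J Q)" "inf I K \<in> (\<lambda>I. I) ` carrier (J Q)"
    by (auto simp: order_ideals_def)
qed simp

section \<open>Antichains in triangular and rectangular grids\<close>

text \<open>For \<open>p = n\<close> and \<open>q = 0\<close> this is the poset of two-element subsets of \<open>[n]\<close>, and for
  \<open>p = q = a\<close>, \<open>n = a + b\<close> it is \<open>[a] \<times> [b]\<close> with the second coordinate shifted by \<open>a\<close>.\<close>

definition grid :: "nat \<Rightarrow> nat \<Rightarrow> nat \<Rightarrow> (nat \<times> nat) set" where
  "grid p q n = {(i, j). 1 \<le> i \<and> i \<le> p \<and> q < j \<and> j \<le> n \<and> i < j}"

text \<open>\<open>2 * k - 1 - i\<close> is the mirror position of \<open>i\<close>: the lower half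
  of the list holds the first coordinates of an antichain, the upper half its second coordinates in
  reverse. With \<open>p = n\<close> and \<open>q = 0\<close> these are the
  \<open>2k\<close>-subsets of \<open>[n]\<close>; with \<open>p = q = a\<close> and
  \<open>n = a + b\<close> the list is cut at the value \<open>a\<close> into \<open>k\<close> small
  and \<open>k\<close> large entries.\<close>

definition split_lists :: "nat \<Rightarrow> nat \<Rightarrow> nat \<Rightarrow> nat \<Rightarrow> nat list set" where
  "split_lists p q n k = {zs. sorted_wrt (<) zs \<and> length zs = 2 * k \<and> set zs \<subseteq> {1..n} \<and>
     (\<forall>i<k. zs ! i \<le> p \<and> q < zs ! (2 * k - 1 - i))}"

definition split_poset :: "nat \<Rightarrow> nat \<Rightarrow> nat \<Rightarrow> nat \<Rightarrow> nat list poset" where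
  "split_poset p q n k =
    \<lparr>carrier = split_lists p q n k, le = (\<lambda>xs ys. \<forall>i<2*k. xs ! i \<le> ys ! i)\<rparr>"

text \<open>The nested pairing, so that an antichain (first coordinates increasing, second coordinates
  decreasing) is read off a single increasing list from the outside inwards.\<close>

definition nested_pairs :: "nat list \<Rightarrow> nat \<Rightarrow> (nat \<times> nat) set" where
  "nested_pairs zs k = (\<lambda>i. (zs ! i, zs ! (2 * k - 1 - i))) ` {..<k}"

lemma carrier_split_poset [simp]: "carrier (split_poset p q n k) = split_lists p q n k"
  and le_split_poset [simp]:
    "le (split_poset p q n k) xs ys \<longleftrightarrow> (\<forall>i<2*k. xs ! i \<le> ys ! i)"
  by (simp_all add: split_poset_def)

lemma split_listsD:
  assumes "zs \<in> split_lists p q n k"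
  shows "sorted_wrt (<) zs" "length zs = 2 * k" "\<And>i. i < 2 * k \<Longrightarrow> 1 \<le> zs ! i \<and> zs ! i \<le> n"
    "\<And>i. i < k \<Longrightarrow> zs ! i \<le> p" "\<And>i. i < k \<Longrightarrow> q < zs ! (2 * k - 1 - i)"
  using assms by (auto simp: split_lists_def subset_iff)

lemma is_poset_split_poset: "is_poset (split_poset p q n k)"
proof -
  have "xs = ys" if "xs \<in> split_lists p q n k" "ys \<in> split_lists p q n k"
    "\<forall>i<2*k. xs ! i \<le> ys ! i" "\<forall>i<2*k. ys ! i \<le> xs ! i" for xs ys
    using that split_listsD(2) by (intro nth_equalityI) (simp_all add: order.antisym)
  then show ?thesis
    unfolding is_poset_def by (auto intro: order.trans)
qed

lemma finite_split_lists: "finite (split_lists p q n k)"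
  by (rule finite_subset[OF _ finite_lists_length_eq[of "{1..n}" "2 * k"]])
    (auto simp: split_lists_def)

section \<open>Bijection between split lists and the antichains of a grid\<close>

lemma nth_strict_sorted:
  fixes zs :: "nat list"
  assumes "sorted_wrt (<) zs" "i < length zs" "j < length zs"
  shows "zs ! i < zs ! j \<longleftrightarrow> i < j"
proof -
  consider "i < j" | "i = j" | "j < i" by linarith
  then show ?thesis
    using sorted_wrt_nth_less[OF assms(1), of i j] sorted_wrt_nth_less[OF assms(1), of j i] assms(2,3)
    by cases auto
qed

lemma nth_strict_sorted_eq:
  fixes zs :: "nat list"
  assumes "sorted_wrt (<) zs" "i < length zs" "j < length zs"
  shows "zs ! i = zs ! j \<longleftrightarrow> i = j"
  using nth_strict_sorted[OF assms] nth_strict_sorted[OF assms(1,3,2)] by (cases i j rule: linorder_cases) auto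

lemma inj_nested_pairs:
  assumes "zs \<in> split_lists p q n k"
  shows "inj_on (\<lambda>i. (zs ! i, zs ! (2 * k - 1 - i))) {..<k}"
  using split_listsD[OF assms] by (intro inj_onI) (auto simp: nth_strict_sorted_eq)

text \<open>Of two nested intervals the outer one has the smaller left end and the larger right end,
  so they are incomparable componentwise.\<close>

lemma nested_pairs_antichain:
  assumes zs: "zs \<in> split_lists p q n k"
  shows "nested_pairs zs k \<in> antichains_k (subposet (grid p q n)) k"
proof -
  note D = split_listsD[OF zs]
  have "(zs ! i, zs ! (2 * k - 1 - i)) \<in> grid p q n" if "i < k" for i
  proof -
    have "zs ! i < zs ! (2 * k - 1 - i)" using that D(2) nth_strict_sorted[OF D(1)] by simp
    then show ?thesis using D(3)[of i] D(3)[of "2 * k - 1 - i"] D(4,5)[OF that] that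
      by (simp add: grid_def)
  qed
  then have "nested_pairs zs k \<subseteq> grid p q n" by (auto simp: nested_pairs_def)
  moreover have "i = j" if "i < k" "j < k" "zs ! i \<le> zs ! j"
    "zs ! (2 * k - 1 - i) \<le> zs ! (2 * k - 1 - j)" for i j
  proof -
    have "\<not> j < i" using nth_strict_sorted[OF D(1), of j i] D(2) that by simp
    moreover have "\<not> 2 * k - 1 - j < 2 * k - 1 - i"
      using nth_strict_sorted[OF D(1), of "2 * k - 1 - j" "2 * k - 1 - i"] D(2) that by simp
    ultimately show ?thesis using that(1,2) by linarith
  qed
  then have "\<forall>x\<in>nested_pairs zs k. \<forall>y\<in>nested_pairs zs k. x \<le> y \<longrightarrow> x = y"
    by (auto simp: nested_pairs_def)
  moreover have "card (nested_pairs zs k) = k"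
    unfolding nested_pairs_def using card_image[OF inj_nested_pairs[OF zs]] by simp
  moreover have "finite (nested_pairs zs k)" by (simp add: nested_pairs_def)
  ultimately show ?thesis by (simp add: antichains_k_def antichain_def)
qed

lemma set_take_drop_nested_pairs:
  assumes "length zs = 2 * k"
  shows "fst ` nested_pairs zs k = set (take k zs)" "snd ` nested_pairs zs k = set (drop k zs)"
proof -
  show "fst ` nested_pairs zs k = set (take k zs)"
    using assms by (force simp: nested_pairs_def image_image set_conv_nth)
  have "(\<lambda>i. zs ! (2 * k - 1 - i)) ` {..<k} = (\<lambda>i. zs ! (k + i)) ` {..<k}"
  proof (intro equalityI subsetI; elim imageE)
    fix x i assume "x = zs ! (2 * k - 1 - i)" "i \<in> {..<k}"
    moreover from this have "2 * k - 1 - i = k + (k - 1 - i)" by simp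
    ultimately show "x \<in> (\<lambda>i. zs ! (k + i)) ` {..<k}"
      by (intro image_eqI[of _ _ "k - 1 - i"]) simp_all
  next
    fix x i assume "x = zs ! (k + i)" "i \<in> {..<k}"
    moreover from this have "2 * k - 1 - (k - 1 - i) = k + i" by simp
    ultimately show "x \<in> (\<lambda>i. zs ! (2 * k - 1 - i)) ` {..<k}"
      by (intro image_eqI[of _ _ "k - 1 - i"]) simp_all
  qed
  then show "snd ` nested_pairs zs k = set (drop k zs)"
    using assms by (force simp: nested_pairs_def image_image set_conv_nth)
qed

text \<open>The first coordinates give the set of entries in the lower half of the list, the second
  coordinates that in the upper half, and a strictly increasing list is determined by its
  set.\<close>

lemma nested_pairs_inj:
  assumes zs: "zs \<in> split_lists p q n k" and ws: "ws \<in> split_lists p q n k"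
    and eq: "nested_pairs zs k = nested_pairs ws k"
  shows "zs = ws"
proof -
  note D = split_listsD[OF zs] and E = split_listsD[OF ws]
  have "sorted_wrt (<) (take k zs)" "sorted_wrt (<) (take k ws)"
    "sorted_wrt (<) (drop k zs)" "sorted_wrt (<) (drop k ws)"
    using D(1) E(1) by (simp_all add: sorted_wrt_take sorted_wrt_drop)
  moreover have "set (take k zs) = set (take k ws)" "set (drop k zs) = set (drop k ws)"
    using set_take_drop_nested_pairs[OF D(2)] set_take_drop_nested_pairs[OF E(2)] eq by simp_all
  ultimately have "take k zs = take k ws" "drop k zs = drop k ws"
    by (simp_all add: strict_sorted_equal)
  then show ?thesis by (metis append_take_drop_id)
qed

lemma ex_list_sorted_by_fst:
  fixes A :: "(nat \<times> nat) set"
  assumes "finite A" "inj_on fst A"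
  shows "\<exists>as. set as = A \<and> length as = card A \<and> sorted_wrt (\<lambda>x y. fst x < fst y) as"
proof -
  define xs where "xs = sorted_list_of_set (fst ` A)"
  let ?g = "inv_into A fst"
  have xs: "set xs = fst ` A" "sorted_wrt (<) xs" using assms(1) by (simp_all add: xs_def)
  have "set (map ?g xs) = A" using assms(2) xs(1) by (auto simp: image_image)
  moreover have "length (map ?g xs) = card A"
    using assms by (simp add: xs_def card_image)
  moreover have "sorted_wrt (\<lambda>x y. fst x < fst y) (map ?g xs)"
    unfolding sorted_wrt_map
    by (rule sorted_wrt_mono_rel[OF _ xs(2)]) (simp add: xs(1) f_inv_into_f)
  ultimately show ?thesis by blast
qed

text \<open>Two pairs with equal first coordinates are comparable, so an antichain can be sorted
  strictly by first coordinate; incomparability then makes the second coordinates strictly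
  decrease.\<close>

lemma nested_pairs_surj:
  assumes A: "A \<in> antichains_k (subposet (grid p q n)) k"
  shows "\<exists>zs\<in>split_lists p q n k. nested_pairs zs k = A"
proof -
  have sub: "A \<subseteq> grid p q n" and fin: "finite A" and card: "card A = k"
    and anti: "\<And>x y. x \<in> A \<Longrightarrow> y \<in> A \<Longrightarrow> x \<le> y \<Longrightarrow> x = y"
    using A by (auto simp: antichains_k_def antichain_def)
  have "inj_on fst A"
  proof (rule inj_onI)
    fix x y :: "nat \<times> nat" assume xy: "x \<in> A" "y \<in> A" "fst x = fst y"
    then have "x \<le> y \<or> y \<le> x" by (cases x; cases y) auto
    then show "x = y" using anti xy by metis
  qed
  then obtain as where as: "set as = A" "length as = k" "sorted_wrt (\<lambda>x y. fst x < fst y) as"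
    using ex_list_sorted_by_fst[OF fin] card by blast
  have fst_less: "fst (as ! i) < fst (as ! j)" if "i < j" "j < k" for i j
    using sorted_wrt_nth_less[OF as(3) that(1)] that(2) as(2) by simp
  have snd_less: "snd (as ! j) < snd (as ! i)" if "i < j" "j < k" for i j
  proof (rule ccontr)
    assume "\<not> ?thesis"
    then have "as ! i \<le> as ! j" using fst_less[OF that] by (simp add: less_eq_prod_def)
    moreover have "as ! i \<in> A" "as ! j \<in> A" using as(1,2) that by auto
    ultimately show False using anti fst_less[OF that] by fastforce
  qed
  have in_grid: "as ! i \<in> grid p q n" if "i < k" for i using as(1,2) that sub by auto
  \<comment> \<open>Both pairs are compared with the inner one, of index \<open>max i j\<close>,
    whose left end lies below its right end because it belongs to the grid.\<close>
  have fst_snd: "fst (as ! i) < snd (as ! j)" if "i < k" "j < k" for i j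
  proof -
    define m where "m = max i j"
    have m: "m < k" "i \<le> m" "j \<le> m" using that by (simp_all add: m_def)
    have "fst (as ! i) \<le> fst (as ! m)"
      using fst_less[of i m] m by (cases "i = m") simp_all
    also have "\<dots> < snd (as ! m)" using in_grid[OF m(1)] by (auto simp: grid_def)
    also have "\<dots> \<le> snd (as ! j)"
      using snd_less[of j m] m by (cases "j = m") simp_all
    finally show ?thesis .
  qed
  define zs where "zs = map fst as @ rev (map snd as)"
  have len: "length zs = 2 * k" using as(2) by (simp add: zs_def)
  have lo: "zs ! i = fst (as ! i)" if "i < k" for i
    using that as(2) by (simp add: zs_def nth_append)
  have hi: "zs ! (2 * k - 1 - i) = snd (as ! i)" if "i < k" for i
  proof -
    have "2 * k - 1 - i = length (map fst as) + (k - 1 - i)" using that as(2) by simp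
    then have "zs ! (2 * k - 1 - i) = rev (map snd as) ! (k - 1 - i)"
      unfolding zs_def by (simp only: nth_append_length_plus)
    then show ?thesis using that as(2) by (simp add: rev_nth)
  qed
  have "sorted_wrt (<) zs"
    unfolding zs_def sorted_wrt_append
  proof (intro conjI ballI)
    show "sorted_wrt (<) (map fst as)" using as(3) by (simp add: sorted_wrt_map)
    show "sorted_wrt (<) (rev (map snd as))"
      unfolding sorted_wrt_rev sorted_wrt_map sorted_wrt_iff_nth_less[of _ as]
      using snd_less as(2) by simp
    fix x y assume "x \<in> set (map fst as)" "y \<in> set (rev (map snd as))"
    then obtain i j where "i < k" "j < k" "x = fst (as ! i)" "y = snd (as ! j)"
      using as(2) by (auto simp: in_set_conv_nth)
    then show "x < y" using fst_snd by simp
  qed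
  moreover have "set zs \<subseteq> {1..n}"
    using as(1) sub by (auto simp: zs_def grid_def)
  moreover have "zs ! i \<le> p \<and> q < zs ! (2 * k - 1 - i)" if "i < k" for i
    using in_grid[OF that] lo[OF that] hi[OF that] by (auto simp: grid_def)
  ultimately have "zs \<in> split_lists p q n k" using len by (simp add: split_lists_def)
  moreover have "nested_pairs zs k = nth as ` {..<k}"
    unfolding nested_pairs_def by (rule image_cong) (simp_all only: lo hi prod.collapse lessThan_iff)
  moreover have "nth as ` {..<k} = A" using as(1,2) by (auto simp: set_conv_nth)
  ultimately show ?thesis by blast
qed

section \<open>Elementary steps and the componentwise order of split lists\<close>

text \<open>Number of coordinates, of either kind, below the threshold \<open>t\<close>. It depends
  on the antichain only, so steps can be compared with lists without tracking the position of the
  moved pair.\<close>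

definition below_count :: "nat \<Rightarrow> (nat \<times> nat) set \<Rightarrow> nat" where
  "below_count t A = (\<Sum>(x, y)\<in>A. of_bool (x < t) + of_bool (y < t))"

text \<open>The mirror map carries the lower half of the indices onto the upper half, so the two
  sums over \<open>i < k\<close> together run over all \<open>2k\<close> positions.\<close>

lemma below_count_nested_pairs:
  assumes zs: "zs \<in> split_lists p q n k"
  shows "below_count t (nested_pairs zs k) = card {i. i < 2 * k \<and> zs ! i < t}"
proof -
  let ?h = "\<lambda>i. of_bool (zs ! i < t) :: nat"
  have "below_count t (nested_pairs zs k) = (\<Sum>i<k. ?h i + ?h (2 * k - 1 - i))"
    unfolding below_count_def nested_pairs_def
    by (subst sum.reindex[OF inj_nested_pairs[OF zs]]) simp
  also have "\<dots> = (\<Sum>i<k. ?h i) + (\<Sum>i<k. ?h (2 * k - 1 - i))" by (rule sum.distrib)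
  also have "(\<Sum>i<k. ?h (2 * k - 1 - i)) = (\<Sum>i\<in>{k..<2*k}. ?h i)"
    by (rule sum.reindex_bij_witness[of _ "\<lambda>i. 2 * k - 1 - i" "\<lambda>i. 2 * k - 1 - i"]) auto
  also have "(\<Sum>i<k. ?h i) + (\<Sum>i\<in>{k..<2*k}. ?h i) = (\<Sum>i<2*k. ?h i)"
    unfolding lessThan_atLeast0 by (rule sum.atLeastLessThan_concat) simp_all
  also have "\<dots> = card ({..<2*k} \<inter> {i. zs ! i < t})" by (simp add: sum.If_cases of_bool_def)
  also have "{..<2*k} \<inter> {i. zs ! i < t} = {i. i < 2 * k \<and> zs ! i < t}" by blast
  finally show ?thesis .
qed

lemma below_count_kstep:
  assumes "kstep (subposet S) k A B"
  shows "below_count t B \<le> below_count t A"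
proof -
  from assms obtain a b where fin: "finite A" "finite B" and ab: "A - B = {a}" "B - A = {b}" "a \<le> b"
    unfolding kstep_def antichains_k_def by auto
  have "below_count t A = below_count t (A \<inter> B) + below_count t {a}"
    using sum.Int_Diff[OF fin(1), of _ B] ab(1) by (simp add: below_count_def)
  moreover have "below_count t B = below_count t (A \<inter> B) + below_count t {b}"
    using sum.Int_Diff[OF fin(2), of _ A] ab(2) by (simp add: below_count_def Int_commute)
  moreover have "below_count t {b} \<le> below_count t {a}"
    using ab(3) by (cases a; cases b) (auto simp: below_count_def)
  ultimately show ?thesis by simp
qed

text \<open>Suppose \<open>ws ! i < zs ! i\<close> and put \<open>t = zs ! i\<close>. Exactly
  \<open>i\<close> entries of \<open>zs\<close> lie below \<open>t\<close>, but at least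
  \<open>i + 1\<close> entries of \<open>ws\<close> do, whereas a step never increases this
  count.\<close>

lemma split_lists_mono:
  assumes zs: "zs \<in> split_lists p q n k" and ws: "ws \<in> split_lists p q n k"
    and step: "kstep (subposet S) k (nested_pairs zs k) (nested_pairs ws k)"
    and i: "i < 2 * k"
  shows "zs ! i \<le> ws ! i"
proof (rule ccontr)
  assume "\<not> ?thesis"
  then have less: "ws ! i < zs ! i" by simp
  note D = split_listsD[OF zs] and E = split_listsD[OF ws]
  have "{j. j < 2 * k \<and> zs ! j < zs ! i} = {..<i}"
    using i D(2) nth_strict_sorted[OF D(1), of _ i] by auto
  moreover have "{..i} \<subseteq> {j. j < 2 * k \<and> ws ! j < zs ! i}"
  proof
    fix j assume "j \<in> {..i}"
    then have "j \<le> i" by simp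
    then have "ws ! j \<le> ws ! i"
      using nth_strict_sorted[OF E(1), of j i] i E(2) by (cases "j = i") auto
    then show "j \<in> {j. j < 2 * k \<and> ws ! j < zs ! i}" using \<open>j \<le> i\<close> i less by simp
  qed
  then have "card {..i} \<le> card {j. j < 2 * k \<and> ws ! j < zs ! i}" by (rule card_mono[rotated]) simp
  ultimately show False
    using below_count_kstep[OF step, of "zs ! i"]
    by (simp add: below_count_nested_pairs[OF zs] below_count_nested_pairs[OF ws])
qed

text \<open>The last entry in which the lists differ is raised by one. Later entries already agree
  with \<open>ws\<close>, and the raised entry is at most \<open>ws ! m\<close>, so it stays below
  them; an earlier entry could collide with its successor.\<close>

lemma split_lists_progress:
  assumes zs: "zs \<in> split_lists p q n k" and ws: "ws \<in> split_lists p q n k"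
    and le: "\<forall>i<2*k. zs ! i \<le> ws ! i" and ne: "zs \<noteq> ws"
  shows "\<exists>us\<in>split_lists p q n k.
    kstep (subposet (grid p q n)) k (nested_pairs zs k) (nested_pairs us k) \<and>
    (\<forall>i<2*k. us ! i \<le> ws ! i)"
proof -
  note D = split_listsD[OF zs] and E = split_listsD[OF ws]
  define m where "m = Max {i. i < 2 * k \<and> zs ! i < ws ! i}"
  have "\<exists>i<2*k. zs ! i \<noteq> ws ! i" using ne D(2) E(2) by (metis nth_equalityI)
  then have ne': "{i. i < 2 * k \<and> zs ! i < ws ! i} \<noteq> {}" using le by (auto simp: order_less_le)
  have "m \<in> {i. i < 2 * k \<and> zs ! i < ws ! i}" unfolding m_def using ne' by (intro Max_in) auto
  then have m: "m < 2 * k" "zs ! m < ws ! m" by simp_all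
  have max: "zs ! i = ws ! i" if "m < i" "i < 2 * k" for i
  proof (rule ccontr)
    assume "zs ! i \<noteq> ws ! i"
    then have "zs ! i < ws ! i" using le that by (simp add: order_less_le)
    then have "i \<le> m" unfolding m_def using that by (intro Max_ge) auto
    then show False using that by simp
  qed
  define us where "us = zs[m := zs ! m + 1]"
  have us_nth: "us ! i = (if i = m then zs ! m + 1 else zs ! i)" if "i < 2 * k" for i
    using that D(2) m(1) by (simp add: us_def)
  have len: "length us = 2 * k" using D(2) by (simp add: us_def)
  have us_ge: "zs ! i \<le> us ! i" and us_le: "us ! i \<le> ws ! i" if "i < 2 * k" for i
    using us_nth[OF that] m le that by auto
  have "sorted_wrt (<) us"
    unfolding sorted_wrt_iff_nth_less len
  proof (intro allI impI)
    fix i j assume ij: "i < j" "j < 2 * k"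
    have zij: "zs ! i < zs ! j" using ij D(1,2) by (simp add: nth_strict_sorted)
    show "us ! i < us ! j"
    proof (cases "i = m")
      case True
      have "us ! m \<le> ws ! m" using us_le m(1) by simp
      also have "\<dots> < ws ! j" using ij True E(1,2) by (simp add: nth_strict_sorted)
      finally show ?thesis using max[of j] us_nth[of j] ij True by simp
    next
      case False
      then show ?thesis using us_nth[of i] us_ge[of j] ij zij by simp
    qed
  qed
  moreover have "set us \<subseteq> {1..n}"
  proof
    fix x assume "x \<in> set us"
    then obtain i where "i < 2 * k" "x = us ! i" using len by (auto simp: in_set_conv_nth)
    then show "x \<in> {1..n}" using us_ge[of i] us_le[of i] D(3)[of i] E(3)[of i] by auto
  qed
  \<comment> \<open>The upper bound \<open>p\<close> is inherited from \<open>ws\<close>, the lower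
    bound \<open>q\<close> from \<open>zs\<close>.\<close>
  moreover have "us ! i \<le> p \<and> q < us ! (2 * k - 1 - i)" if "i < k" for i
  proof
    have "i < 2 * k" "2 * k - 1 - i < 2 * k" using that by simp_all
    then have "us ! i \<le> ws ! i" "zs ! (2 * k - 1 - i) \<le> us ! (2 * k - 1 - i)"
      using us_le us_ge by blast+
    then show "us ! i \<le> p" "q < us ! (2 * k - 1 - i)"
      using E(4)[OF that] D(5)[OF that] by linarith+
  qed
  ultimately have us: "us \<in> split_lists p q n k" using len by (simp add: split_lists_def)
  \<comment> \<open>Index of the nested pair that contains position \<open>m\<close>, either as its
    left or as its right end; it is the only pair that changes.\<close>
  define r where "r = (if m < k then m else 2 * k - 1 - m)"
  let ?a = "\<lambda>i. (zs ! i, zs ! (2 * k - 1 - i))" and ?b = "\<lambda>i. (us ! i, us ! (2 * k - 1 - i))"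
  have r: "r < k" using m(1) by (auto simp: r_def)
  have same: "?a i = ?b i" if "i < k" "i \<noteq> r" for i
  proof -
    have "i \<noteq> m" "2 * k - 1 - i \<noteq> m" using that m(1) by (auto simp: r_def split: if_splits)
    then show ?thesis using us_nth[of i] us_nth[of "2 * k - 1 - i"] that by simp
  qed
  have less: "?a r \<le> ?b r" "?a r \<noteq> ?b r"
  proof -
    show "?a r \<le> ?b r" using us_ge[of r] us_ge[of "2 * k - 1 - r"] r by simp
    show "?a r \<noteq> ?b r"
    proof (cases "m < k")
      case True
      then show ?thesis using us_nth[of m] m(1) by (simp add: r_def)
    next
      case False
      then have "2 * k - 1 - r = m" using m(1) by (simp add: r_def)
      then show ?thesis using us_nth[of m] m(1) by simp
    qed
  qed
  have inja: "?a i = ?a j \<Longrightarrow> i = j" and injb: "?b i = ?b j \<Longrightarrow> i = j" if "i < k" "j < k" for i j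
    using inj_nested_pairs[OF zs] inj_nested_pairs[OF us] that by (auto simp: inj_on_def)
  have "?a r \<notin> nested_pairs us k"
  proof
    assume "?a r \<in> nested_pairs us k"
    then obtain j where j: "j < k" "?a r = ?b j" by (auto simp: nested_pairs_def)
    then show False using same[of j] inja[OF r j(1)] less(2) by metis
  qed
  moreover have "?b r \<notin> nested_pairs zs k"
  proof
    assume "?b r \<in> nested_pairs zs k"
    then obtain j where j: "j < k" "?b r = ?a j" by (auto simp: nested_pairs_def)
    then show False using same[of j] injb[OF r j(1)] less(2) by metis
  qed
  moreover have "nested_pairs zs k - nested_pairs us k \<subseteq> {?a r}"
    "nested_pairs us k - nested_pairs zs k \<subseteq> {?b r}"
    unfolding nested_pairs_def using same by force+
  moreover have "?a r \<in> nested_pairs zs k" "?b r \<in> nested_pairs us k"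
    using r by (simp_all add: nested_pairs_def)
  ultimately have "nested_pairs zs k - nested_pairs us k = {?a r}"
    "nested_pairs us k - nested_pairs zs k = {?b r}" by blast+
  then have "kstep (subposet (grid p q n)) k (nested_pairs zs k) (nested_pairs us k)"
    unfolding kstep_def using nested_pairs_antichain[OF zs] nested_pairs_antichain[OF us] less
    by (intro conjI exI[of _ "?a r"] exI[of _ "?b r"]) simp_all
  then show ?thesis using us us_le by blast
qed

lemma Ak_grid_iso: "poset_iso (Ak (subposet (grid p q n)) k) (split_poset p q n k)"
proof (rule Ak_isoI[OF is_poset_split_poset, where g = "\<lambda>zs. nested_pairs zs k"])
  show "finite (carrier (split_poset p q n k))" by (simp add: finite_split_lists)
  show "bij_betw (\<lambda>zs. nested_pairs zs k) (carrier (split_poset p q n k))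
     (antichains_k (subposet (grid p q n)) k)"
    unfolding bij_betw_def
  proof
    show "inj_on (\<lambda>zs. nested_pairs zs k) (carrier (split_poset p q n k))"
      by (rule inj_onI) (simp add: nested_pairs_inj)
    show "(\<lambda>zs. nested_pairs zs k) ` carrier (split_poset p q n k)
        = antichains_k (subposet (grid p q n)) k"
    proof (intro equalityI subsetI)
      fix A assume "A \<in> antichains_k (subposet (grid p q n)) k"
      then show "A \<in> (\<lambda>zs. nested_pairs zs k) ` carrier (split_poset p q n k)"
        using nested_pairs_surj by force
    next
      fix A assume "A \<in> (\<lambda>zs. nested_pairs zs k) ` carrier (split_poset p q n k)"
      then show "A \<in> antichains_k (subposet (grid p q n)) k"
        using nested_pairs_antichain by auto
    qed
  qed
qed (simp_all add: split_lists_mono split_lists_progress)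

lemma is_distributive_lattice_split_poset: "is_distributive_lattice (split_poset p q n k)"
proof (rule is_distributive_lattice_embed[OF is_poset_split_poset,
      where f = "\<lambda>zs i. if i < 2 * k then zs ! i else 0"])
  fix xs ys assume "xs \<in> carrier (split_poset p q n k)" "ys \<in> carrier (split_poset p q n k)"
  then have xs: "xs \<in> split_lists p q n k" and ys: "ys \<in> split_lists p q n k" by simp_all
  note D = split_listsD[OF xs] and E = split_listsD[OF ys]
  \<comment> \<open>The default value 0 beyond position \<open>2k\<close> makes the order on
    functions compare exactly the entries of the lists.\<close>
  show "le (split_poset p q n k) xs ys \<longleftrightarrow>
    (\<lambda>i. if i < 2 * k then xs ! i else 0) \<le> (\<lambda>i. if i < 2 * k then ys ! i else 0)"
    by (auto simp: le_fun_def)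
  \<comment> \<open>Maximum and minimum are treated together: joint strict monotonicity of
    \<open>h\<close> keeps the list increasing, and since \<open>h\<close> returns one of its
    arguments, all bounds on entries survive.\<close>
  have closed: "(\<lambda>i. if i < 2 * k then h (xs ! i) (ys ! i) else 0)
      \<in> (\<lambda>zs i. if i < 2 * k then zs ! i else 0) ` carrier (split_poset p q n k)"
    if h: "\<And>a b c d::nat. a < c \<Longrightarrow> b < d \<Longrightarrow> h a b < h c d" "\<And>a b::nat. h a b = a \<or> h a b = b"
    for h
  proof
    let ?zs = "map2 h xs ys"
    have nth: "?zs ! i = h (xs ! i) (ys ! i)" if "i < 2 * k" for i using that D(2) E(2) by simp
    have len: "length ?zs = 2 * k" using D(2) E(2) by simp
    have "sorted_wrt (<) ?zs"
      unfolding sorted_wrt_iff_nth_less len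
    proof (intro allI impI)
      fix i j assume "i < j" "j < 2 * k"
      then show "?zs ! i < ?zs ! j"
        using h(1) nth[of i] nth[of j] D(1,2) E(1,2) by (simp add: nth_strict_sorted)
    qed
    moreover have "set ?zs \<subseteq> {1..n}"
    proof
      fix x assume "x \<in> set ?zs"
      then obtain i where i: "i < 2 * k" "x = ?zs ! i" unfolding in_set_conv_nth len by blast
      then show "x \<in> {1..n}" using nth[of i] h(2)[of "xs ! i" "ys ! i"] D(3)[of i] E(3)[of i] by auto
    qed
    moreover have "?zs ! i \<le> p \<and> q < ?zs ! (2 * k - 1 - i)" if "i < k" for i
      using nth[of i] nth[of "2 * k - 1 - i"] h(2)[of "xs ! i" "ys ! i"]
        h(2)[of "xs ! (2 * k - 1 - i)" "ys ! (2 * k - 1 - i)"] D(4,5)[OF that] E(4,5)[OF that] that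
      by auto
    ultimately show "?zs \<in> carrier (split_poset p q n k)"
      using len by (simp add: split_lists_def)
    show "(\<lambda>i. if i < 2 * k then h (xs ! i) (ys ! i) else 0)
      = (\<lambda>i. if i < 2 * k then ?zs ! i else 0)"
      using nth by (simp add: fun_eq_iff)
  qed
  have "(\<lambda>i. if i < 2 * k then sup (xs ! i) (ys ! i) else 0)
      \<in> (\<lambda>zs i. if i < 2 * k then zs ! i else 0) ` carrier (split_poset p q n k)"
    by (rule closed) (auto simp: sup_nat_def)
  moreover have "sup (\<lambda>i. if i < 2 * k then xs ! i else 0) (\<lambda>i. if i < 2 * k then ys ! i else 0)
      = (\<lambda>i. if i < 2 * k then sup (xs ! i) (ys ! i) else 0)"
    by (simp add: fun_eq_iff)
  ultimately show "sup (\<lambda>i. if i < 2 * k then xs ! i else 0) (\<lambda>i. if i < 2 * k then ys ! i else 0)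
      \<in> (\<lambda>zs i. if i < 2 * k then zs ! i else 0) ` carrier (split_poset p q n k)"
    by simp
  have "(\<lambda>i. if i < 2 * k then inf (xs ! i) (ys ! i) else 0)
      \<in> (\<lambda>zs i. if i < 2 * k then zs ! i else 0) ` carrier (split_poset p q n k)"
    by (rule closed) (auto simp: inf_nat_def)
  moreover have "inf (\<lambda>i. if i < 2 * k then xs ! i else 0) (\<lambda>i. if i < 2 * k then ys ! i else 0)
      = (\<lambda>i. if i < 2 * k then inf (xs ! i) (ys ! i) else 0)"
    by (simp add: fun_eq_iff)
  ultimately show "inf (\<lambda>i. if i < 2 * k then xs ! i else 0) (\<lambda>i. if i < 2 * k then ys ! i else 0)
      \<in> (\<lambda>zs i. if i < 2 * k then zs ! i else 0) ` carrier (split_poset p q n k)"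
    by simp
qed

section \<open>Grids as models of \<open>[a] \<times> [b]\<close>, \<open>C(n,2)\<close> and
  \<open>J([n] \<times> [2])\<close>\<close>

lemma carrier_chain [simp]: "carrier (chain n) = {1..n}"
  and le_chain [simp]: "le (chain n) = (\<le>)"
  by (simp_all add: chain_def)

lemma carrier_prod_poset [simp]: "carrier (prod_poset P Q) = carrier P \<times> carrier Q"
  and le_prod_poset [simp]: "le (prod_poset P Q) (a, b) (c, d) \<longleftrightarrow> le P a c \<and> le Q b d"
  by (simp_all add: prod_poset_def)

lemma carrier_Cnk [simp]:
    "carrier (Cnk n k) = {xs. sorted_wrt (<) xs \<and> length xs = k \<and> set xs \<subseteq> {1..n}}"
  and le_Cnk [simp]: "le (Cnk n k) xs ys \<longleftrightarrow> (\<forall>i<k. xs ! i \<le> ys ! i)"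
  by (simp_all add: Cnk_def)

lemma is_poset_prod_chain: "is_poset (prod_poset (chain a) (chain b))"
  unfolding is_poset_def by auto

text \<open>After the shift first coordinates are at most \<open>a\<close> and second ones exceed
  \<open>a\<close>, so the condition \<open>i < j\<close> of the grid holds for every pair.\<close>

lemma prod_chain_iso_grid: "poset_iso (prod_poset (chain a) (chain b)) (subposet (grid a a (a + b)))"
proof (rule poset_iso_subposetI[where f = "\<lambda>(x, y). (x, a + y)"])
  show "(\<lambda>(x, y). (x, a + y)) ` carrier (prod_poset (chain a) (chain b)) = grid a a (a + b)"
  proof (intro equalityI subsetI)
    fix z assume "z \<in> grid a a (a + b)"
    then show "z \<in> (\<lambda>(x, y). (x, a + y)) ` carrier (prod_poset (chain a) (chain b))"
      by (intro image_eqI[of _ _ "(fst z, snd z - a)"]) (auto simp: grid_def)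
  qed (auto simp: grid_def)
qed (auto simp: is_poset_prod_chain)

text \<open>An antichain of \<open>[a] \<times> [b]\<close> amounts to independent choices of
  \<open>k\<close> first and \<open>k\<close> second coordinates; concatenation after the shift by
  \<open>a\<close> is one increasing list, and cutting it in the middle is the inverse.\<close>

lemma prod_Cnk_iso_split_poset:
  "poset_iso (prod_poset (Cnk a k) (Cnk b k)) (split_poset a a (a + b) k)"
proof (rule poset_isoI[where f = "\<lambda>(xs, ys). xs @ map ((+) a) ys"])
  let ?f = "\<lambda>(xs, ys). xs @ map ((+) a) ys"
  let ?C = "carrier (prod_poset (Cnk a k) (Cnk b k))"
  have "inj_on ?f ?C"
  proof (rule inj_onI)
    fix v w assume vw: "v \<in> ?C" "w \<in> ?C" "?f v = ?f w"
    obtain xs ys xs' ys' where eq: "v = (xs, ys)" "w = (xs', ys')" by (cases v; cases w)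
    have "length xs = length xs'" using vw(1,2) by (simp add: eq)
    then have "xs = xs'" "map ((+) a) ys = map ((+) a) ys'" using vw(3) by (simp_all add: eq)
    then show "v = w" using inj_map_eq_map[OF inj_on_add, of a ys ys'] by (simp add: eq)
  qed
  moreover have "?f ` ?C = split_lists a a (a + b) k"
  proof (intro equalityI subsetI)
    fix z assume "z \<in> ?f ` ?C"
    then obtain xs ys where z: "z = xs @ map ((+) a) ys"
      and xs: "sorted_wrt (<) xs" "length xs = k" "set xs \<subseteq> {1..a}"
      and ys: "sorted_wrt (<) ys" "length ys = k" "set ys \<subseteq> {1..b}"
      by auto
    have "sorted_wrt (<) z"
      unfolding z sorted_wrt_append sorted_wrt_map using xs ys by fastforce
    moreover have "set z \<subseteq> {1..a + b}" unfolding z using xs(3) ys(3) by fastforce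
    moreover have "z ! i \<le> a" if "i < k" for i
    proof -
      have "xs ! i \<in> {1..a}" using xs(2,3) nth_mem[of i xs] that by blast
      then show ?thesis using that xs(2) by (simp add: z nth_append)
    qed
    moreover have "a < z ! (2 * k - 1 - i)" if "i < k" for i
    proof -
      have "2 * k - 1 - i = length xs + (k - 1 - i)" using that xs(2) by simp
      then have "z ! (2 * k - 1 - i) = map ((+) a) ys ! (k - 1 - i)"
        unfolding z by (simp only: nth_append_length_plus)
      also have "\<dots> = a + ys ! (k - 1 - i)" using that ys(2) by simp
      finally show ?thesis using nth_mem[of "k - 1 - i" ys] ys(2,3) that by fastforce
    qed
    ultimately show "z \<in> split_lists a a (a + b) k"
      using xs(2) ys(2) by (simp add: split_lists_def z)
  next
    fix z assume z: "z \<in> split_lists a a (a + b) k"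
    note D = split_listsD[OF z]
    have lo: "x \<in> {1..a}" if "x \<in> set (take k z)" for x
    proof -
      from that obtain i where "i < k" "x = z ! i" using D(2) by (auto simp: in_set_conv_nth)
      then show ?thesis using D(3)[of i] D(4)[of i] by simp
    qed
    have hi: "x \<in> {a<..a + b}" if "x \<in> set (drop k z)" for x
    proof -
      from that obtain i where i: "i < k" "x = z ! (k + i)" using D(2) by (auto simp: in_set_conv_nth)
      have "2 * k - 1 - (k - 1 - i) = k + i" using i(1) by simp
      then show ?thesis using D(3)[of "k + i"] D(5)[of "k - 1 - i"] i by simp
    qed
    let ?xs = "take k z" and ?ys = "map (\<lambda>x. x - a) (drop k z)"
    have "map ((+) a) ?ys = drop k z"
      unfolding map_map by (rule map_idI) (use hi in force)
    then have eq: "z = ?f (?xs, ?ys)" by simp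
    have "sorted_wrt (<) ?ys"
      unfolding sorted_wrt_map
      by (rule sorted_wrt_mono_rel[OF _ sorted_wrt_drop[OF D(1)]]) (use hi in force)
    then have "(?xs, ?ys) \<in> ?C"
      using D(1,2) lo hi by (force simp: sorted_wrt_take)
    with eq show "z \<in> ?f ` ?C" by (rule image_eqI)
  qed
  ultimately show "bij_betw ?f ?C (carrier (split_poset a a (a + b) k))" by (simp add: bij_betw_def)
  fix v w assume "v \<in> ?C" "w \<in> ?C"
  then obtain xs ys xs' ys' where vw: "v = (xs, ys)" "w = (xs', ys')"
    and len: "length xs = k" "length ys = k" "length xs' = k" "length ys' = k"
    by auto
  have "(\<forall>i<2*k. (xs @ map ((+) a) ys) ! i \<le> (xs' @ map ((+) a) ys') ! i) \<longleftrightarrow>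
    (\<forall>i<k. xs ! i \<le> xs' ! i) \<and> (\<forall>i<k. ys ! i \<le> ys' ! i)" (is "?L \<longleftrightarrow> ?R")
  proof
    assume L: ?L
    have "xs ! i \<le> xs' ! i" if "i < k" for i
      using L[rule_format, of i] that len by (simp add: nth_append)
    moreover have "ys ! i \<le> ys' ! i" if "i < k" for i
      using L[rule_format, of "k + i"] that len by (simp add: nth_append)
    ultimately show ?R by blast
  next
    assume R: ?R
    show ?L
    proof (intro allI impI)
      fix i assume "i < 2 * k"
      then show "(xs @ map ((+) a) ys) ! i \<le> (xs' @ map ((+) a) ys') ! i"
        using R len by (simp add: nth_append)
    qed
  qed
  then show "le (prod_poset (Cnk a k) (Cnk b k)) v w \<longleftrightarrow>
      le (split_poset a a (a + b) k) (?f v) (?f w)"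
    by (simp add: vw)
qed

lemma split_poset_eq_Cnk: "split_poset n 0 n k = Cnk n (2 * k)"
proof -
  have "zs ! i \<le> n \<and> 0 < zs ! (2 * k - 1 - i)"
    if "length zs = 2 * k" "set zs \<subseteq> {1..n}" "i < k" for zs i
    using nth_mem[of i zs] nth_mem[of "2 * k - 1 - i" zs] that by fastforce
  then show ?thesis
    by (auto simp: split_poset_def Cnk_def split_lists_def)
qed

lemma Cnk_2_iso_grid: "poset_iso (Cnk n 2) (subposet (grid n 0 n))"
proof (rule poset_iso_subposetI[where f = "\<lambda>xs. (xs ! 0, xs ! 1)"])
  show le: "le (Cnk n 2) xs ys \<longleftrightarrow> (xs ! 0, xs ! 1) \<le> (ys ! 0, ys ! 1)" for xs ys
    by (auto simp: numeral_2_eq_2 less_Suc_eq)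
  have Cnk_2: "carrier (Cnk n 2) = {[i, j] |i j. (i, j) \<in> grid n 0 n}"
    by (auto simp: grid_def numeral_2_eq_2 length_Suc_conv)
  show "is_poset (Cnk n 2)"
    unfolding is_poset_def le Cnk_2 by auto
  show "(\<lambda>xs. (xs ! 0, xs ! 1)) ` carrier (Cnk n 2) = grid n 0 n"
  proof (intro equalityI subsetI)
    fix z assume z: "z \<in> grid n 0 n"
    then show "z \<in> (\<lambda>xs. (xs ! 0, xs ! 1)) ` carrier (Cnk n 2)"
      unfolding Cnk_2 by (intro image_eqI[of _ _ "[fst z, snd z]"]) auto
  qed (unfold Cnk_2, auto)
qed

text \<open>An ideal of \<open>[n] \<times> [2]\<close> has \<open>u\<close> elements with second
  coordinate 1 and \<open>v \<le> u\<close> with second coordinate 2; it is coded by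
  \<open>(v + 1, u + 2)\<close>, which turns \<open>v \<le> u\<close> into \<open>i < j\<close>. The
  principal ideal of \<open>(x, 1)\<close> has \<open>u = x\<close>, \<open>v = 0\<close>, that of
  \<open>(x, 2)\<close> has \<open>u = v = x\<close>, and \<open>(1, 2)\<close> is the empty
  ideal.\<close>

lemma J_prod_chain_2_iso_grid:
  "poset_iso (J (prod_poset (chain n) (chain 2))) (subposet (grid (n + 2) 0 (n + 2)))"
proof (rule J_iso_subposet[where \<phi> = "\<lambda>(x, y). if y = 1 then (1, x + 2) else (x + 1, x + 2)"])
  let ?Q = "prod_poset (chain n) (chain 2)"
  let ?S = "grid (n + 2) 0 (n + 2)"
  let ?\<phi> = "\<lambda>(x, y). if y = 1 then (1, x + 2) else (x + 1, x + 2)"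
  show "is_poset ?Q" by (rule is_poset_prod_chain)
  show "finite (carrier ?Q)" by simp
  show "s \<le> t" if s: "s \<in> ?S" "t \<in> ?S" and le: "\<And>q. q \<in> carrier ?Q \<Longrightarrow> ?\<phi> q \<le> s \<Longrightarrow> ?\<phi> q \<le> t" for s t
  proof -
    obtain i j i' j' where ij: "s = (i, j)" "t = (i', j')" by (cases s; cases t)
    \<comment> \<open>Each coordinate is detected by one generator: \<open>(i - 1, 2)\<close> has
      image \<open>(i, i + 1)\<close>, and below \<open>(j - 2, 1)\<close> has image
      \<open>(1, j)\<close>. The least values \<open>i = 1\<close> and \<open>j = 2\<close> need no
      generator.\<close>
    have "i \<le> i'"
    proof (cases "i = 1")
      case False
      then obtain c where c: "i = Suc c" "1 \<le> c" using s by (cases i) (auto simp: ij grid_def)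
      then have "c \<le> n" "c + 2 \<le> j" using s by (auto simp: ij grid_def)
      then show ?thesis using le[of "(c, 2)"] c by (auto simp: ij)
    qed (use s in \<open>simp add: ij grid_def\<close>)
    moreover have "j \<le> j'"
    proof (cases "j = 2")
      case False
      then have "2 < j" using s by (auto simp: ij grid_def)
      then obtain c where c: "j = c + 2" "1 \<le> c" using le_Suc_ex[of 2 j] by (auto simp: add.commute)
      then have "c \<le> n" "1 \<le> i" using s by (auto simp: ij grid_def)
      then show ?thesis using le[of "(c, 1)"] c by (auto simp: ij)
    qed (use s in \<open>simp add: ij grid_def\<close>)
    ultimately show ?thesis by (simp add: ij)
  qed
  show "?\<phi> p \<le> ?\<phi> q" if "p \<in> carrier ?Q" "q \<in> carrier ?Q" "le ?Q p q" for p q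
    using that by auto
  show "\<exists>s\<in>?S. \<forall>q\<in>carrier ?Q. \<not> ?\<phi> q \<le> s"
    by (rule bexI[of _ "(1, 2)"]) (auto simp: grid_def)
  show "\<exists>t\<in>?S. \<forall>p\<in>carrier ?Q. ?\<phi> p \<le> t \<longleftrightarrow> ?\<phi> p \<le> s \<or> p = q"
    if s: "s \<in> ?S" and q: "q \<in> carrier ?Q" "\<not> ?\<phi> q \<le> s"
      and below: "\<And>p. p \<in> carrier ?Q \<Longrightarrow> le ?Q p q \<Longrightarrow> p \<noteq> q \<Longrightarrow> ?\<phi> p \<le> s" for s q
  proof -
    obtain i j x y where eq: "s = (i, j)" "q = (x, y)" by (cases s; cases q)
    have x: "1 \<le> x" "x \<le> n" "y = 1 \<or> y = 2" using q(1) by (auto simp: eq)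
    have ij: "1 \<le> i" "i < j" "j \<le> n + 2" using s by (auto simp: eq grid_def)
    show ?thesis
    proof (cases "y = 1")
      case True
      have "x + 1 \<le> j"
      proof (cases "x = 1")
        case False
        then obtain c where "x = Suc c" "1 \<le> c" using x by (cases x) auto
        then show ?thesis using below[of "(c, 1)"] x True by (auto simp: eq)
      qed (use ij in simp)
      \<comment> \<open>The first row of the ideal ends just before \<open>x\<close>, that is
        \<open>u = x - 1\<close>, so adding \<open>(x, 1)\<close> raises \<open>j\<close> by
        one.\<close>
      then have "j = x + 1" using q(2) True ij by (auto simp: eq)
      then show ?thesis
        using ij x True by (intro bexI[of _ "(i, x + 2)"]) (auto simp: eq grid_def)
    next
      case False
      then have y: "y = 2" using x by simp
      have "x + 2 \<le> j" using below[of "(x, 1)"] x y by (auto simp: eq)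
      moreover have "x \<le> i"
      proof (cases "x = 1")
        case False
        then obtain c where "x = Suc c" "1 \<le> c" using x by (cases x) auto
        then show ?thesis using below[of "(c, 2)"] x y by (auto simp: eq)
      qed (use ij in simp)
      ultimately have "i = x" using q(2) y by (auto simp: eq)
      then show ?thesis
        using ij x y \<open>x + 2 \<le> j\<close> by (intro bexI[of _ "(x + 1, j)"]) (auto simp: eq grid_def)
    qed
  qed
qed

section \<open>The iterates of \<open>J\<close> on \<open>[2] \<times> [2]\<close>\<close>

text \<open>The two off-diagonal points lie between \<open>(m, m)\<close> and
  \<open>(m + 1, m + 1)\<close>. These four form the diamond, with \<open>m\<close> diagonal points
  below it and \<open>m\<close> above; for \<open>m = 0\<close> it is
  \<open>[2] \<times> [2]\<close> with coordinates starting at 0.\<close>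

definition diamond_chain :: "nat \<Rightarrow> (nat \<times> nat) set" where
  "diamond_chain m = {(i, j). i = j \<and> i \<le> 2 * m + 1 \<or> i = m \<and> j = m + 1 \<or> i = m + 1 \<and> j = m}"

lemma finite_diamond_chain: "finite (diamond_chain m)"
  by (rule finite_subset[of _ "{..2 * m + 1} \<times> {..2 * m + 1}"]) (auto simp: diamond_chain_def)

lemma diamond_chain_cases:
  assumes "x \<in> diamond_chain m"
  obtains i where "x = (i, i)" "i \<le> m" | "x = (m, m + 1)" | "x = (m + 1, m)"
    | i where "x = (i, i)" "m + 1 \<le> i" "i \<le> 2 * m + 1"
  using assms by (cases x) (force simp: diamond_chain_def)

text \<open>Besides the principal ideals there are just the empty one, coded by
  \<open>(0, 0)\<close>, and the one generated by the two middle points, coded by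
  \<open>(m + 2, m + 2)\<close>. Hence principal ideals are shifted by one up to the middle and by
  two from \<open>(m + 1, m + 1)\<close> on.\<close>

lemma J_diamond_chain:
  "poset_iso (J (subposet (diamond_chain m))) (subposet (diamond_chain (m + 1)))"
proof (rule J_iso_subposet[where \<phi> = "\<lambda>(i, j). if i \<le> m \<or> j \<le> m then (i + 1, j + 1) else (i + 2, j + 2)"])
  let ?Q = "subposet (diamond_chain m)" and ?S = "diamond_chain (m + 1)"
  let ?\<phi> = "\<lambda>(i, j). if i \<le> m \<or> j \<le> m then (i + 1, j + 1) else (i + 2, j + 2)"
  have mid: "(m, m + 1) \<in> diamond_chain m" "(m + 1, m) \<in> diamond_chain m"
    and diag: "(i, i) \<in> diamond_chain n \<longleftrightarrow> i \<le> 2 * n + 1" for i n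
    by (auto simp: diamond_chain_def)
  show "is_poset ?Q" by (rule is_poset_subposet)
  show "finite (carrier ?Q)" by (simp add: finite_diamond_chain)
  show "s \<le> t" if s: "s \<in> ?S" and t: "t \<in> ?S"
    and le: "\<And>q. q \<in> carrier ?Q \<Longrightarrow> ?\<phi> q \<le> s \<Longrightarrow> ?\<phi> q \<le> t" for s t
    using s
  proof (cases rule: diamond_chain_cases)
    case (1 i)
    show ?thesis
    proof (cases i)
      case 0
      then show ?thesis using 1 by (cases t) simp
    next
      case (Suc c)
      then show ?thesis using le[of "(c, c)"] 1 by (simp add: diag)
    qed
  next
    case 2
    then show ?thesis using le[of "(m, m + 1)"] mid by auto
  next
    case 3
    then show ?thesis using le[of "(m + 1, m)"] mid by auto
  next
    case (4 i)
    show ?thesis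
    \<comment> \<open>\<open>(m + 2, m + 2)\<close> is not the image of a generator; the images of
      the two middle points detect it jointly.\<close>
    proof (cases "i = m + 2")
      case True
      then show ?thesis using le[of "(m, m + 1)"] le[of "(m + 1, m)"] mid 4 by (cases t) auto
    next
      case False
      then have "m + 3 \<le> i" using 4 by simp
      then obtain c where "i = c + 2" "m + 1 \<le> c"
        using le_Suc_ex[of 2 i] by (auto simp: add.commute)
      then show ?thesis using le[of "(c, c)"] 4 by (simp add: diag)
    qed
  qed
  show "?\<phi> p \<le> ?\<phi> q" if "p \<in> carrier ?Q" "q \<in> carrier ?Q" "le ?Q p q" for p q
    using that by (cases p; cases q) auto
  show "\<exists>s\<in>?S. \<forall>q\<in>carrier ?Q. \<not> ?\<phi> q \<le> s"
    by (rule bexI[of _ "(0, 0)"]) (auto simp: diag split: if_splits)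
  show "\<exists>t\<in>?S. \<forall>p\<in>carrier ?Q. ?\<phi> p \<le> t \<longleftrightarrow> ?\<phi> p \<le> s \<or> p = q"
    if s: "s \<in> ?S" and q: "q \<in> carrier ?Q" and nle: "\<not> ?\<phi> q \<le> s"
      and below: "\<And>p. p \<in> carrier ?Q \<Longrightarrow> le ?Q p q \<Longrightarrow> p \<noteq> q \<Longrightarrow> ?\<phi> p \<le> s" for s q
  proof -
    have "q \<in> diamond_chain m" using q by simp
    then show ?thesis
    proof (cases rule: diamond_chain_cases)
      case (1 c)
      have "(c, c) \<le> s"
      proof (cases c)
        case 0
        then show ?thesis by (cases s) simp
      next
        case (Suc d)
        then show ?thesis using below[of "(d, d)"] 1 by (simp add: diag)
      qed
      then have "s = (c, c)"
        using s nle 1 by (cases s) (auto simp: diamond_chain_def)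
      then show ?thesis
        using 1 by (intro bexI[of _ "(c + 1, c + 1)"]) (auto simp: diamond_chain_def)
    next
      case 2
      have "(m + 1, m + 1) \<le> s" using below[of "(m, m)"] 2 by (auto simp: diag)
      \<comment> \<open>The other middle point may or may not already belong to the ideal.\<close>
      then have "s = (m + 1, m + 1) \<or> s = (m + 2, m + 1)"
        using s nle 2 by (cases s) (auto simp: diamond_chain_def)
      then show ?thesis
      proof
        assume "s = (m + 1, m + 1)"
        then show ?thesis
          using 2 by (intro bexI[of _ "(m + 1, m + 2)"]) (auto simp: diamond_chain_def)
      next
        assume "s = (m + 2, m + 1)"
        then show ?thesis
          using 2 by (intro bexI[of _ "(m + 2, m + 2)"]) (auto simp: diamond_chain_def)
      qed
    next
      case 3
      have "(m + 1, m + 1) \<le> s" using below[of "(m, m)"] 3 by (auto simp: diag)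
      then have "s = (m + 1, m + 1) \<or> s = (m + 1, m + 2)"
        using s nle 3 by (cases s) (auto simp: diamond_chain_def)
      then show ?thesis
      proof
        assume "s = (m + 1, m + 1)"
        then show ?thesis
          using 3 by (intro bexI[of _ "(m + 2, m + 1)"]) (auto simp: diamond_chain_def)
      next
        assume "s = (m + 1, m + 2)"
        then show ?thesis
          using 3 by (intro bexI[of _ "(m + 2, m + 2)"]) (auto simp: diamond_chain_def)
      qed
    next
      case (4 c)
      have "(c + 1, c + 1) \<le> s"
      proof (cases "c = m + 1")
        case True
        then show ?thesis using below[of "(m, m + 1)"] below[of "(m + 1, m)"] mid 4 by (cases s) auto
      next
        case False
        then obtain d where "c = Suc d" "m + 1 \<le> d" using 4 by (cases c) auto
        then show ?thesis using below[of "(d, d)"] 4 by (simp add: diag)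
      qed
      then have "s = (c + 1, c + 1)"
        using s nle 4 by (cases s) (auto simp: diamond_chain_def)
      then show ?thesis
        using 4 by (intro bexI[of _ "(c + 2, c + 2)"]) (auto simp: diamond_chain_def)
    qed
  qed
qed

lemma Jpow_iso_diamond_chain:
  "poset_iso (Jpow m (prod_poset (chain 2) (chain 2))) (subposet (diamond_chain m))"
proof (induction m)
  case 0
  have "poset_iso (prod_poset (chain 2) (chain 2)) (subposet (diamond_chain 0))"
  proof (rule poset_iso_subposetI[where f = "\<lambda>(x, y). (x - 1, y - 1)"])
    have "carrier (prod_poset (chain 2) (chain 2)) = {(1, 1), (1, 2), (2, 1), (2, 2)}"
      by (auto simp: numeral_2_eq_2 le_Suc_eq)
    moreover have "diamond_chain 0 = {(0, 0), (0, 1), (1, 0), (1, 1)}"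
      by (auto simp: diamond_chain_def le_Suc_eq)
    ultimately show "(\<lambda>(x, y). (x - 1, y - 1)) ` carrier (prod_poset (chain 2) (chain 2)) = diamond_chain 0"
      by simp
  qed (auto simp: is_poset_prod_chain)
  then show ?case using Jpow_0 poset_iso_sym poset_iso_trans by metis
next
  case (Suc m)
  have "poset_iso (Jpow (Suc m) (prod_poset (chain 2) (chain 2)))
      (J (Jpow m (prod_poset (chain 2) (chain 2))))"
    by (rule poset_iso_sym[OF Jpow_Suc]) simp
  moreover have "poset_iso \<dots> (J (subposet (diamond_chain m)))" using Suc by (rule J_cong)
  moreover have "poset_iso \<dots> (subposet (diamond_chain (Suc m)))"
    using J_diamond_chain[of m] by simp
  ultimately show ?case by (metis poset_iso_trans)
qed

text \<open>A diagonal point is comparable to every other point, so an antichain with two members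
  consists of the two middle points.\<close>

lemma antichains_diamond_chain:
  assumes A: "A \<in> antichains_k (subposet (diamond_chain m)) k" and k: "2 \<le> k"
  shows "A = {(m, m + 1), (m + 1, m)} \<and> k = 2"
proof -
  let ?M = "{(m, m + 1), (m + 1, m)}"
  have "finite A" "card A = k" "A \<subseteq> diamond_chain m"
    and anti: "\<And>x y. x \<in> A \<Longrightarrow> y \<in> A \<Longrightarrow> x \<le> y \<Longrightarrow> x = y"
    using A by (auto simp: antichains_k_def antichain_def)
  have "A \<subseteq> ?M"
  proof
    fix x assume x: "x \<in> A"
    have "\<not> A \<subseteq> {x}" using card_mono[of "{x}" A] k \<open>card A = k\<close> by auto
    then obtain y where y: "y \<in> A" "y \<noteq> x" by blast
    have nle: "\<not> x \<le> y" "\<not> y \<le> x" using anti[of x y] anti[of y x] x y by auto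
    have "x \<in> diamond_chain m" and yD: "y \<in> diamond_chain m"
      using x y \<open>A \<subseteq> diamond_chain m\<close> by auto
    from this(1) show "x \<in> ?M"
    proof (cases rule: diamond_chain_cases)
      case (1 i)
      from yD nle 1 show ?thesis by (elim diamond_chain_cases) auto
    next
      case (4 i)
      from yD nle 4 show ?thesis by (elim diamond_chain_cases) auto
    qed auto
  qed
  moreover have "card ?M = 2" by simp
  ultimately show ?thesis
    using card_mono[of ?M A] card_subset_eq[of ?M A] k \<open>card A = k\<close> by fastforce
qed

lemma antichains_k_2_diamond_chain:
  "antichains_k (subposet (diamond_chain m)) 2 = {{(m, m + 1), (m + 1, m)}}"
proof -
  have "{(m, m + 1), (m + 1, m)} \<in> antichains_k (subposet (diamond_chain m)) 2"
    by (auto simp: antichains_k_def antichain_def diamond_chain_def)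
  then show ?thesis using antichains_diamond_chain by blast
qed

section \<open>The exceptional posets\<close>

text \<open>The generator test of \<open>J_iso_subposet\<close> with \<open>\<phi>\<close> given as
  an association list: all its conditions become bounded quantifiers over explicit lists, which
  evaluation decides.\<close>

lemma J_iso_table:
  fixes tb :: "('a::order \<times> 'b::order) list"
  assumes dist: "distinct (map fst tb)"
    and emb: "\<forall>s\<in>set S. \<forall>t\<in>set S. (\<forall>(q, f)\<in>set tb. f \<le> s \<longrightarrow> f \<le> t) \<longrightarrow> s \<le> t"
    and mono: "\<forall>(p, f)\<in>set tb. \<forall>(q, g)\<in>set tb. p \<le> q \<longrightarrow> f \<le> g"
    and bot: "\<exists>s\<in>set S. \<forall>(q, f)\<in>set tb. \<not> f \<le> s"
    and step: "\<forall>s\<in>set S. \<forall>(q, f)\<in>set tb. \<not> f \<le> s \<longrightarrow>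
      (\<forall>(p, g)\<in>set tb. p \<le> q \<longrightarrow> p \<noteq> q \<longrightarrow> g \<le> s) \<longrightarrow>
      (\<exists>t\<in>set S. \<forall>(p, g)\<in>set tb. g \<le> t \<longleftrightarrow> g \<le> s \<or> p = q)"
  shows "poset_iso (J (subposet (set (map fst tb)))) (subposet (set S))"
proof -
  define \<phi> where "\<phi> q = the (map_of tb q)" for q
  have \<phi>: "\<phi> q = f" if "(q, f) \<in> set tb" for q f
    using map_of_is_SomeI[OF dist that] by (simp add: \<phi>_def)
  define D where "D = set (map fst tb)"
  have split: "(\<forall>(q, f)\<in>set tb. R q f) \<longleftrightarrow> (\<forall>q\<in>D. R q (\<phi> q))" for R
    unfolding D_def using \<phi> by force
  show ?thesis
    unfolding D_def[symmetric]
  proof (rule J_iso_subposet[where \<phi> = \<phi>])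
    show "s \<le> t" if "s \<in> set S" "t \<in> set S"
      and "\<And>q. q \<in> carrier (subposet D) \<Longrightarrow> \<phi> q \<le> s \<Longrightarrow> \<phi> q \<le> t" for s t
      using emb that unfolding split by simp
    show "\<phi> p \<le> \<phi> q" if "p \<in> carrier (subposet D)" "q \<in> carrier (subposet D)"
      "le (subposet D) p q" for p q
      using mono that unfolding split by simp
    show "\<exists>s\<in>set S. \<forall>q\<in>carrier (subposet D). \<not> \<phi> q \<le> s"
      using bot unfolding split by simp
    show "\<exists>t\<in>set S. \<forall>p\<in>carrier (subposet D). \<phi> p \<le> t \<longleftrightarrow> \<phi> p \<le> s \<or> p = q"
      if "s \<in> set S" "q \<in> carrier (subposet D)" "\<not> \<phi> q \<le> s"
      and "\<And>p. p \<in> carrier (subposet D) \<Longrightarrow> le (subposet D) p q \<Longrightarrow> p \<noteq> q \<Longrightarrow> \<phi> p \<le> s"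
      for s q
      using step that unfolding split by simp
  qed (simp_all add: is_poset_subposet D_def)
qed

definition incomp :: "'a::order \<Rightarrow> 'a \<Rightarrow> bool" where
  "incomp a b \<longleftrightarrow> \<not> a \<le> b \<and> \<not> b \<le> a"

text \<open>An elementary step between two-element antichains keeps one element and raises the
  other; the four cases arise because an unordered pair is stored in some order.\<close>

definition pair_step :: "'a::order \<Rightarrow> 'a \<Rightarrow> 'a \<Rightarrow> 'a \<Rightarrow> bool" where
  "pair_step a b c d \<longleftrightarrow> a = c \<and> b < d \<or> a = d \<and> b < c \<or> b = c \<and> a < d \<or> b = d \<and> a < c"

lemma antichains_k_2_iff:
  "A \<in> antichains_k (subposet S) 2 \<longleftrightarrow> (\<exists>a\<in>S. \<exists>b\<in>S. incomp a b \<and> A = {a, b})"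
proof
  assume A: "A \<in> antichains_k (subposet S) 2"
  then obtain a b where ab: "A = {a, b}" "a \<noteq> b"
    by (auto simp: antichains_k_def card_2_iff)
  then show "\<exists>a\<in>S. \<exists>b\<in>S. incomp a b \<and> A = {a, b}"
    using A by (intro bexI[of _ a] bexI[of _ b]) (auto simp: antichains_k_def antichain_def incomp_def)
next
  assume "\<exists>a\<in>S. \<exists>b\<in>S. incomp a b \<and> A = {a, b}"
  then obtain a b where ab: "a \<in> S" "b \<in> S" "incomp a b" "A = {a, b}" by blast
  then have "a \<noteq> b" by (auto simp: incomp_def)
  then show "A \<in> antichains_k (subposet S) 2"
    using ab by (auto simp: antichains_k_def antichain_def incomp_def)
qed

lemma kstep_pair_iff:
  assumes "a \<in> S" "b \<in> S" "incomp a b" "c \<in> S" "d \<in> S" "incomp c d"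
  shows "kstep (subposet S) 2 {a, b} {c, d} \<longleftrightarrow> pair_step a b c d"
proof -
  have A: "{a, b} \<in> antichains_k (subposet S) 2" "{c, d} \<in> antichains_k (subposet S) 2"
    using assms unfolding antichains_k_2_iff by blast+
  have ne: "a \<noteq> b" "c \<noteq> d" using assms by (auto simp: incomp_def)
  show ?thesis
  proof
    assume "kstep (subposet S) 2 {a, b} {c, d}"
    then obtain u v where uv: "{a, b} - {c, d} = {u}" "{c, d} - {a, b} = {v}" "u \<le> v" "u \<noteq> v"
      unfolding kstep_def by auto
    have 1: "x = u \<or> x \<in> {c, d}" if "x \<in> {a, b}" for x using that uv(1) by (metis DiffI singletonD)
    have 2: "u \<in> {a, b}" "u \<notin> {c, d}" using uv(1) by (metis DiffE singletonI)+
    have 3: "v \<in> {c, d}" "v \<notin> {a, b}" using uv(2) by (metis DiffE singletonI)+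
    have "u < v" using uv(3,4) by simp
    then show "pair_step a b c d"
      using 1[of a] 1[of b] 2 3 ne unfolding pair_step_def by auto
  next
    have diff: "kstep (subposet S) 2 {a, b} {c, d}"
      if "{a, b} = {w, u}" "{c, d} = {w, v}" "u < v" for u v w
    proof -
      have "u \<noteq> w" "v \<noteq> w" using that(1,2) ne by auto
      then have "{a, b} - {c, d} = {u}" "{c, d} - {a, b} = {v}" "u \<noteq> v"
        unfolding that(1,2) using that(3) by auto
      then show ?thesis
        unfolding kstep_def using A that(3)
        by (intro conjI exI[of _ u] exI[of _ v]) simp_all
    qed
    assume "pair_step a b c d"
    then show "kstep (subposet S) 2 {a, b} {c, d}"
      unfolding pair_step_def
    proof (elim disjE conjE)
      assume "a = c" "b < d" then show ?thesis by (intro diff[of a b d]) auto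
    next
      assume "a = d" "b < c" then show ?thesis by (intro diff[of a b c]) auto
    next
      assume "b = c" "a < d" then show ?thesis by (intro diff[of b a d]) auto
    next
      assume "b = d" "a < c" then show ?thesis by (intro diff[of b a c]) auto
    qed
  qed
qed

text \<open>An entry \<open>(q, a, b)\<close> assigns the antichain \<open>{a, b}\<close> to
  \<open>q\<close>. The condition \<open>mono\<close> includes equal antichains in either order:
  applied both ways it yields equal keys, hence injectivity, while \<open>complete\<close> gives
  surjectivity.\<close>

lemma Ak_2_iso_table:
  fixes tb :: "('q::order \<times> 'a::order \<times> 'a) list" and S :: "'a set"
  assumes dist: "distinct (map fst tb)"
    and sound: "\<forall>(q, a, b)\<in>set tb. a \<in> S \<and> b \<in> S \<and> incomp a b"
    and complete: "\<forall>a\<in>S. \<forall>b\<in>S. incomp a b \<longrightarrow>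
      (\<exists>(q, c, d)\<in>set tb. c = a \<and> d = b \<or> c = b \<and> d = a)"
    and mono: "\<forall>(p, a, b)\<in>set tb. \<forall>(q, c, d)\<in>set tb.
      pair_step a b c d \<or> a = c \<and> b = d \<or> a = d \<and> b = c \<longrightarrow> p \<le> q"
    and progress: "\<forall>(p, a, b)\<in>set tb. \<forall>(q, _, _)\<in>set tb. p < q \<longrightarrow>
      (\<exists>(r, c, d)\<in>set tb. r \<le> q \<and> pair_step a b c d)"
  shows "poset_iso (Ak (subposet S) 2) (subposet (set (map fst tb)))"
proof -
  define g where "g q = (case the (map_of tb q) of (a, b) \<Rightarrow> {a, b})" for q
  have g: "g q = {a, b}" if "(q, a, b) \<in> set tb" for q a b
    using map_of_is_SomeI[OF dist that] by (simp add: g_def)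
  have ex: "\<exists>a b. (q, a, b) \<in> set tb" if "q \<in> set (map fst tb)" for q
    using that by force
  have in_S: "a \<in> S" "b \<in> S" "incomp a b" if "(q, a, b) \<in> set tb" for q a b
    using sound that by auto
  have kstep_iff: "kstep (subposet S) 2 (g p) (g q) \<longleftrightarrow> pair_step a b c d"
    if "(p, a, b) \<in> set tb" "(q, c, d) \<in> set tb" for p q a b c d
    unfolding g[OF that(1)] g[OF that(2)] using in_S[OF that(1)] in_S[OF that(2)]
    by (rule kstep_pair_iff)
  have le: "p \<le> q" if "(p, a, b) \<in> set tb" "(q, c, d) \<in> set tb"
    "pair_step a b c d \<or> a = c \<and> b = d \<or> a = d \<and> b = c" for p q a b c d
    using bspec[OF mono that(1)] that(2,3) by auto
  show ?thesis
  proof (rule Ak_isoI[where g = g])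
    have "inj_on g (set (map fst tb))"
    proof (rule inj_onI)
      fix p q assume pq: "p \<in> set (map fst tb)" "q \<in> set (map fst tb)" "g p = g q"
      from ex[OF pq(1)] ex[OF pq(2)] obtain a b c d
        where t: "(p, a, b) \<in> set tb" "(q, c, d) \<in> set tb" by blast
      then have "a = c \<and> b = d \<or> a = d \<and> b = c" using pq(3) g by (simp add: doubleton_eq_iff)
      then show "p = q" using le[OF t] le[OF t(2,1)] by (metis order.antisym)
    qed
    moreover have "g ` set (map fst tb) = antichains_k (subposet S) 2"
    proof (intro equalityI subsetI)
      fix A assume "A \<in> g ` set (map fst tb)"
      then obtain q where q: "q \<in> set (map fst tb)" "A = g q" by blast
      from ex[OF q(1)] obtain a b where "(q, a, b) \<in> set tb" by blast
      then show "A \<in> antichains_k (subposet S) 2"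
        unfolding antichains_k_2_iff q(2) using g in_S by metis
    next
      fix A assume "A \<in> antichains_k (subposet S) 2"
      then obtain a b where ab: "a \<in> S" "b \<in> S" "incomp a b" "A = {a, b}"
        unfolding antichains_k_2_iff by blast
      then obtain q c d where t: "(q, c, d) \<in> set tb" "c = a \<and> d = b \<or> c = b \<and> d = a"
        using complete by fast
      then have "A = g q" using g ab(4) by auto
      moreover have "q \<in> set (map fst tb)" using t(1) by force
      ultimately show "A \<in> g ` set (map fst tb)" by blast
    qed
    ultimately show "bij_betw g (carrier (subposet (set (map fst tb)))) (antichains_k (subposet S) 2)"
      by (simp add: bij_betw_def)
  next
    fix p q assume pq: "p \<in> carrier (subposet (set (map fst tb)))"
      "q \<in> carrier (subposet (set (map fst tb)))" "kstep (subposet S) 2 (g p) (g q)"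
    from ex[of p] ex[of q] pq(1,2) obtain a b c d
      where t: "(p, a, b) \<in> set tb" "(q, c, d) \<in> set tb" by auto
    show "le (subposet (set (map fst tb))) p q"
      using le[OF t] pq(3) kstep_iff[OF t] by simp
  next
    fix p q assume pq: "p \<in> carrier (subposet (set (map fst tb)))"
      "q \<in> carrier (subposet (set (map fst tb)))" "le (subposet (set (map fst tb))) p q" "p \<noteq> q"
    from ex[of p] ex[of q] pq(1,2) obtain a b c d
      where t: "(p, a, b) \<in> set tb" "(q, c, d) \<in> set tb" by auto
    have "p < q" using pq(3,4) by simp
    then obtain r u v where r: "(r, u, v) \<in> set tb" "r \<le> q" "pair_step a b u v"
      using bspec[OF progress t(1)] t(2) by fastforce
    have "r \<in> carrier (subposet (set (map fst tb)))" using r(1) by force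
    moreover have "kstep (subposet S) 2 (g p) (g r)" using kstep_iff[OF t(1) r(1)] r(3) by simp
    ultimately show "\<exists>r\<in>carrier (subposet (set (map fst tb))).
        kstep (subposet S) 2 (g p) (g r) \<and> le (subposet (set (map fst tb))) r q"
      using r(2) by auto
  qed (simp_all add: is_poset_subposet)
qed

text \<open>Each member of an antichain with at least three elements lies in a pairwise incomparable
  triple, so one finite test on triples bounds the antichains of all sizes
  \<open>k \<ge> 3\<close>.\<close>

lemma antichain_subset_of_triples:
  assumes A: "A \<in> antichains_k (subposet S) k" and k: "3 \<le> k"
    and triples: "\<forall>a\<in>S. \<forall>b\<in>S. incomp a b \<longrightarrow> (\<forall>c\<in>S. incomp a c \<and> incomp b c \<longrightarrow> a \<in> M)"
  shows "A \<subseteq> M"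
proof
  fix a assume a: "a \<in> A"
  have A': "A \<subseteq> S" "card A = k" "finite A" and anti: "\<And>x y. x \<in> A \<Longrightarrow> y \<in> A \<Longrightarrow> x \<le> y \<Longrightarrow> x = y"
    using A by (auto simp: antichains_k_def antichain_def)
  have "\<not> A \<subseteq> {a}" using card_mono[of "{a}" A] k A'(2) by auto
  then obtain b where b: "b \<in> A" "b \<noteq> a" by blast
  have "card {a, b} \<le> 2" by (simp add: card_insert_if)
  then have "\<not> A \<subseteq> {a, b}" using card_mono[of "{a, b}" A] k A'(2) by auto
  then obtain c where c: "c \<in> A" "c \<noteq> a" "c \<noteq> b" by blast
  have "incomp a b" "incomp a c" "incomp b c"
    using anti a b c unfolding incomp_def by metis+
  then show "a \<in> M" using triples a b(1) c(1) A'(1) by blast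
qed

text \<open>The posets \<open>J\<^sup>2([2] \<times> [3])\<close> and \<open>J\<^sup>3([2] \<times> [3])\<close>: an ideal of a poset covered by two
  chains is recorded by the numbers of its elements in the two chains. The tables below list the
  images of principal ideals, and the two-element antichains that correspond to each element.\<close>

definition e6 :: "(nat \<times> nat) list" where
  "e6 = [(0, 0), (1, 0), (2, 0), (2, 1), (3, 0), (3, 1), (3, 2), (3, 3),
   (4, 0), (4, 1), (4, 2), (4, 3), (5, 2), (5, 3), (6, 3), (7, 3)]"

definition e7 :: "(nat \<times> nat) list" where
  "e7 = [(0, 0), (1, 0), (2, 0), (3, 0), (3, 1), (3, 2), (4, 0), (4, 1),
   (4, 2), (5, 1), (5, 2), (5, 3), (6, 1), (6, 2), (6, 3), (6, 4),
   (6, 5), (7, 1), (7, 2), (7, 3), (7, 4), (7, 5), (8, 4), (8, 5),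
   (9, 5), (10, 5), (11, 5)]"

text \<open>Writing \<open>ij\<close> for \<open>(i, j)\<close>, the covering chains are 12, 13, 14,
  15, 25, 35, 45 and 23, 24, 34; this accounts for the top element \<open>(7, 3)\<close>.\<close>

definition grid_to_e6 :: "((nat \<times> nat) \<times> (nat \<times> nat)) list" where
  "grid_to_e6 =
  [((1, 2), (1, 0)), ((1, 3), (2, 0)), ((1, 4), (3, 0)), ((1, 5), (4, 0)),
   ((2, 3), (2, 1)), ((2, 4), (3, 2)), ((2, 5), (5, 2)), ((3, 4), (3, 3)),
   ((3, 5), (6, 3)), ((4, 5), (7, 3))]"

text \<open>In the same notation the covering chains of \<open>e6\<close> are 00, 10, 20, 21, 31,
  32, 33, 43, 53, 63, 73 and 30, 40, 41, 42, 52, of lengths 11 and 5.\<close>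

definition e6_to_e7 :: "((nat \<times> nat) \<times> (nat \<times> nat)) list" where
  "e6_to_e7 =
  [((0, 0), (1, 0)), ((1, 0), (2, 0)), ((2, 0), (3, 0)), ((2, 1), (4, 0)),
   ((3, 0), (3, 1)), ((3, 1), (5, 1)), ((3, 2), (6, 1)), ((3, 3), (7, 1)),
   ((4, 0), (3, 2)), ((4, 1), (5, 3)), ((4, 2), (6, 4)), ((4, 3), (8, 4)),
   ((5, 2), (6, 5)), ((5, 3), (9, 5)), ((6, 3), (10, 5)), ((7, 3), (11, 5))]"

text \<open>The diamond arises at key \<open>(3, 3)\<close>: in \<open>{(3, 2), (4, 0)}\<close>
  either \<open>(3, 2)\<close> is raised to \<open>(3, 3)\<close> or \<open>(4, 0)\<close> to
  \<open>(4, 1)\<close>, and both moves together lead to key \<open>(4, 4)\<close>.\<close>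

definition e6_pairs :: "((nat \<times> nat) \<times> (nat \<times> nat) \<times> (nat \<times> nat)) list" where
  "e6_pairs =
  [((0, 0), (2, 1), (3, 0)), ((1, 1), (2, 1), (4, 0)), ((2, 2), (3, 1), (4, 0)),
   ((3, 3), (3, 2), (4, 0)), ((3, 4), (3, 2), (4, 1)), ((4, 3), (3, 3), (4, 0)),
   ((4, 4), (3, 3), (4, 1)), ((5, 5), (3, 3), (4, 2)), ((6, 6), (3, 3), (5, 2)),
   ((7, 7), (4, 3), (5, 2))]"

text \<open>The keys run through \<open>e7\<close> itself. In the middle, each member of the
  three-element antichain \<open>{(5, 3), (6, 2), (7, 1)}\<close> is the key of the other
  two.\<close>

definition e7_pairs :: "((nat \<times> nat) \<times> (nat \<times> nat) \<times> (nat \<times> nat)) list" where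
  "e7_pairs =
  [((0, 0), (3, 1), (4, 0)), ((1, 0), (3, 2), (4, 0)), ((2, 0), (3, 2), (4, 1)),
   ((3, 0), (3, 2), (5, 1)), ((3, 1), (3, 2), (6, 1)), ((4, 0), (4, 2), (5, 1)),
   ((3, 2), (3, 2), (7, 1)), ((4, 1), (4, 2), (6, 1)), ((5, 1), (5, 2), (6, 1)),
   ((4, 2), (4, 2), (7, 1)), ((6, 1), (5, 3), (6, 1)), ((7, 1), (5, 3), (6, 2)),
   ((5, 2), (5, 2), (7, 1)), ((5, 3), (6, 2), (7, 1)), ((6, 2), (5, 3), (7, 1)),
   ((7, 2), (5, 3), (7, 2)), ((6, 3), (6, 3), (7, 1)), ((6, 4), (6, 4), (7, 1)),
   ((6, 5), (6, 5), (7, 1)), ((7, 3), (6, 3), (7, 2)), ((7, 4), (6, 4), (7, 2)),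
   ((8, 4), (6, 4), (7, 3)), ((7, 5), (6, 5), (7, 2)), ((8, 5), (6, 5), (7, 3)),
   ((9, 5), (6, 5), (7, 4)), ((10, 5), (6, 5), (8, 4)), ((11, 5), (7, 5), (8, 4))]"

section \<open>Checking the tables by evaluation\<close>

lemma J_grid_iso_e6: "poset_iso (J (subposet (grid 5 0 5))) (subposet (set e6))"
proof -
  have "poset_iso (J (subposet (set (map fst grid_to_e6)))) (subposet (set e6))"
    by (rule J_iso_table; code_simp)
  moreover have "set (map fst grid_to_e6) = grid 5 0 5"
  proof -
    have "grid 5 0 5 = set (filter (\<lambda>(i, j). i < j) (List.product [1..<6] [1..<6]))"
      by (auto simp: grid_def)
    also have "\<dots> = set (map fst grid_to_e6)" by code_simp
    finally show ?thesis by simp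
  qed
  ultimately show ?thesis by simp
qed

lemma J_e6_iso_e7: "poset_iso (J (subposet (set e6))) (subposet (set e7))"
proof -
  have "poset_iso (J (subposet (set (map fst e6_to_e7)))) (subposet (set e7))"
    by (rule J_iso_table; code_simp)
  moreover have "map fst e6_to_e7 = e6" by code_simp
  ultimately show ?thesis by simp
qed

lemma Ak_2_e6_iso: "poset_iso (Ak (subposet (set e6)) 2) (subposet (diamond_chain 3))"
proof -
  have "poset_iso (Ak (subposet (set e6)) 2) (subposet (set (map fst e6_pairs)))"
    by (rule Ak_2_iso_table; code_simp)
  moreover have "set (map fst e6_pairs) = diamond_chain 3"
  proof -
    have "diamond_chain 3 = set (map (\<lambda>i. (i, i)) [0..<8] @ [(3, 4), (4, 3)])"
      by (auto simp: diamond_chain_def)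
    also have "\<dots> = set (map fst e6_pairs)" by code_simp
    finally show ?thesis by simp
  qed
  ultimately show ?thesis by simp
qed

lemma Ak_2_e7_iso: "poset_iso (Ak (subposet (set e7)) 2) (subposet (set e7))"
proof -
  have "poset_iso (Ak (subposet (set e7)) 2) (subposet (set (map fst e7_pairs)))"
    by (rule Ak_2_iso_table; code_simp)
  moreover have "set (map fst e7_pairs) = set e7" by code_simp
  ultimately show ?thesis by simp
qed

lemma antichains_e6:
  assumes "3 \<le> k" shows "antichains_k (subposet (set e6)) k = {}"
proof -
  have "\<forall>a\<in>set e6. \<forall>b\<in>set e6. incomp a b \<longrightarrow>
      (\<forall>c\<in>set e6. incomp a c \<and> incomp b c \<longrightarrow> a \<in> {})"
    by code_simp
  then have "A \<subseteq> {}" if "A \<in> antichains_k (subposet (set e6)) k" for A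
    using antichain_subset_of_triples[OF that assms] by blast
  then show ?thesis using assms by (force simp: antichains_k_def)
qed

lemma antichains_e7:
  assumes "A \<in> antichains_k (subposet (set e7)) k" "3 \<le> k"
  shows "A = {(5, 3), (6, 2), (7, 1)} \<and> k = 3"
proof -
  let ?M = "{(5, 3), (6, 2), (7, 1)} :: (nat \<times> nat) set"
  have "\<forall>a\<in>set e7. \<forall>b\<in>set e7. incomp a b \<longrightarrow>
      (\<forall>c\<in>set e7. incomp a c \<and> incomp b c \<longrightarrow> a \<in> ?M)"
    by code_simp
  then have sub: "A \<subseteq> ?M" by (rule antichain_subset_of_triples[OF assms])
  have "card ?M = 3" "finite ?M" by simp_all
  moreover have "card A = k" using assms(1) by (simp add: antichains_k_def)
  ultimately show ?thesis
    using card_mono[OF _ sub] card_subset_eq[OF _ sub] assms(2) by force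
qed

lemma antichains_k_3_e7: "antichains_k (subposet (set e7)) 3 = {{(5, 3), (6, 2), (7, 1)}}"
proof -
  have "{(5, 3), (6, 2), (7, 1)} \<in> antichains_k (subposet (set e7)) 3"
    by (auto simp: antichains_k_def antichain_def e7_def)
  then show ?thesis using antichains_e7[of _ 3] by blast
qed

section \<open>The families of minuscule posets\<close>

lemma Ak_prod_chain_iso:
  assumes "poset_iso P (prod_poset (chain a) (chain b))"
  shows "poset_iso (Ak P k) (split_poset a a (a + b) k)"
  using poset_iso_trans[OF Ak_cong[OF poset_iso_trans[OF assms prod_chain_iso_grid]] Ak_grid_iso] .

lemma Ak_J_prod_chain_2_iso:
  assumes "poset_iso P (J (prod_poset (chain n) (chain 2)))"
  shows "poset_iso (Ak P k) (Cnk (n + 2) (2 * k))"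
  using poset_iso_trans[OF Ak_cong[OF poset_iso_trans[OF assms J_prod_chain_2_iso_grid]] Ak_grid_iso]
  unfolding split_poset_eq_Cnk .

lemma Ak_Cnk_2_iso: "poset_iso (Ak (Cnk n 2) k) (Cnk n (2 * k))"
  using poset_iso_trans[OF Ak_cong[OF Cnk_2_iso_grid] Ak_grid_iso]
  unfolding split_poset_eq_Cnk .

lemma Jpow_Suc_distributive:
  "is_distributive_lattice (Jpow (Suc m) (prod_poset (chain 2) (chain 2)))"
  by (rule is_distributive_lattice_iso[OF poset_iso_sym[OF Jpow_Suc] is_distributive_lattice_J]) simp

text \<open>The product is isomorphic to its own poset of one-element antichains, so distributivity
  is the case \<open>k = 1\<close> of the result on split lists.\<close>

lemma prod_chain_distributive: "is_distributive_lattice (prod_poset (chain a) (chain b))"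
proof -
  have "poset_iso (prod_poset (chain a) (chain b)) (Ak (prod_poset (chain a) (chain b)) 1)"
    by (rule poset_iso_sym[OF Ak_1_iso]) (simp_all add: is_poset_prod_chain)
  from this Ak_prod_chain_iso[OF poset_iso_refl] have "poset_iso (prod_poset (chain a) (chain b))
      (split_poset a a (a + b) 1)" by (rule poset_iso_trans)
  then show ?thesis using is_distributive_lattice_split_poset by (rule is_distributive_lattice_iso)
qed

text \<open>For \<open>m = 0\<close> no \<open>J\<close> has been applied, so lattices of ideals
  give no information and the product of chains is used instead.\<close>

lemma Jpow_distributive: "is_distributive_lattice (Jpow m (prod_poset (chain 2) (chain 2)))"
proof (cases m)
  case 0
  have "is_distributive_lattice (Jpow 0 (prod_poset (chain 2) (chain 2)))"
    using poset_iso_sym[OF Jpow_0] prod_chain_distributive by (rule is_distributive_lattice_iso)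
  then show ?thesis by (simp add: 0)
qed (simp add: Jpow_Suc_distributive)

lemma finite_carrier_iso: "poset_iso P Q \<Longrightarrow> finite (carrier Q) \<Longrightarrow> finite (carrier P)"
  unfolding poset_iso_def using bij_betw_finite by blast

lemma Ak_1_iso_subposet:
  assumes "poset_iso P (subposet S)" "finite S"
  shows "poset_iso (Ak P 1) P"
  using assms is_poset_iso[OF assms(1) is_poset_subposet] finite_carrier_iso[OF assms(1)]
  by (intro Ak_1_iso) simp_all

lemma is_singleton_poset_iso:
  assumes "poset_iso P Q" "is_singleton_poset Q" shows "is_singleton_poset P"
proof -
  from assms(1) obtain f where "bij_betw f (carrier P) (carrier Q)" unfolding poset_iso_def by blast
  then have "card (carrier P) = card (carrier Q)" by (rule bij_betw_same_card)
  also have "\<dots> = 1" using assms(2) by (auto simp: is_singleton_poset_def)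
  finally show ?thesis by (simp add: is_singleton_poset_def card_1_singleton_iff)
qed

lemma is_distributive_lattice_Ak_empty:
  assumes "poset_iso P Q" "antichains_k Q k = {}" shows "is_distributive_lattice (Ak P k)"
  by (rule is_distributive_lattice_iso[OF Ak_cong[OF assms(1)]])
    (simp add: assms(2) is_distributive_lattice_empty)

lemma J_J_2_3_iso_e6:
  "poset_iso (J (J (prod_poset (chain 2) (chain 3)))) (subposet (set e6))"
proof -
  \<comment> \<open>The factors are exchanged so that the description of
    \<open>J([n] \<times> [2])\<close> applies with \<open>n = 3\<close>, which yields the grid on
    \<open>[5]\<close>.\<close>
  have "poset_iso (prod_poset (chain 2) (chain 3)) (prod_poset (chain 3) (chain 2))"
  proof (rule poset_isoI[of prod.swap])
    show "bij_betw prod.swap (carrier (prod_poset (chain 2) (chain 3)))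
        (carrier (prod_poset (chain 3) (chain 2)))"
      by (simp add: bij_betw_def product_swap)
  qed auto
  then have "poset_iso (J (prod_poset (chain 2) (chain 3))) (J (prod_poset (chain 3) (chain 2)))"
    by (rule J_cong)
  moreover have "poset_iso (J (prod_poset (chain 3) (chain 2))) (subposet (grid 5 0 5))"
    using J_prod_chain_2_iso_grid[of 3] by simp
  ultimately have "poset_iso (J (prod_poset (chain 2) (chain 3))) (subposet (grid 5 0 5))"
    by (rule poset_iso_trans)
  from poset_iso_trans[OF J_cong[OF this] J_grid_iso_e6] show ?thesis .
qed

lemma J_J_J_2_3_iso_e7:
  "poset_iso (J (J (J (prod_poset (chain 2) (chain 3))))) (subposet (set e7))"
  using J_cong[OF J_J_2_3_iso_e6] J_e6_iso_e7 by (rule poset_iso_trans)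

lemma Ak_Jpow_2_2:
  assumes "poset_iso P (Jpow m (prod_poset (chain 2) (chain 2)))"
  shows "poset_iso (Ak P 1) P" "is_singleton_poset (Ak P 2)" "is_distributive_lattice (Ak P k)"
proof -
  have iso: "poset_iso P (subposet (diamond_chain m))"
    using assms Jpow_iso_diamond_chain by (rule poset_iso_trans)
  show 1: "poset_iso (Ak P 1) P" using iso finite_diamond_chain by (rule Ak_1_iso_subposet)
  show 2: "is_singleton_poset (Ak P 2)"
    by (rule is_singleton_poset_iso[OF Ak_cong[OF iso]])
      (simp add: is_singleton_poset_def antichains_k_2_diamond_chain)
  consider "k = 0" | "k = 1" | "k = 2" | "k \<ge> 3" by linarith
  then show "is_distributive_lattice (Ak P k)"
  proof cases
    case 1
    then show ?thesis
      using is_distributive_lattice_Ak_singleton[OF is_singleton_poset_Ak_0] by simp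
  next
    case 2
    then show ?thesis
      using is_distributive_lattice_iso[OF poset_iso_trans[OF 1 assms] Jpow_distributive] by simp
  next
    case 3
    then show ?thesis using is_distributive_lattice_Ak_singleton[OF 2] by simp
  next
    case 4
    then have "antichains_k (subposet (diamond_chain m)) k = {}"
      using antichains_diamond_chain[of _ m k] by force
    with iso show ?thesis by (rule is_distributive_lattice_Ak_empty)
  qed
qed

lemma Ak_J_J_2_3:
  assumes "poset_iso P (J (J (prod_poset (chain 2) (chain 3))))"
  shows "poset_iso (Ak P 1) P" "poset_iso (Ak P 2) (Jpow 3 (prod_poset (chain 2) (chain 2)))"
    "is_distributive_lattice (Ak P k)"
proof -
  have iso: "poset_iso P (subposet (set e6))"
    using assms J_J_2_3_iso_e6 by (rule poset_iso_trans)
  show 1: "poset_iso (Ak P 1) P" using iso finite_set by (rule Ak_1_iso_subposet)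
  have "poset_iso (Ak P 2) (subposet (diamond_chain 3))"
    using Ak_cong[OF iso] Ak_2_e6_iso by (rule poset_iso_trans)
  then show 2: "poset_iso (Ak P 2) (Jpow 3 (prod_poset (chain 2) (chain 2)))"
    using poset_iso_sym[OF Jpow_iso_diamond_chain] by (rule poset_iso_trans)
  consider "k = 0" | "k = 1" | "k = 2" | "k \<ge> 3" by linarith
  then show "is_distributive_lattice (Ak P k)"
  proof cases
    case 1
    then show ?thesis
      using is_distributive_lattice_Ak_singleton[OF is_singleton_poset_Ak_0] by simp
  next
    case 2
    then show ?thesis
      using is_distributive_lattice_iso[OF poset_iso_trans[OF 1 assms] is_distributive_lattice_J] by simp
  next
    case 3
    then show ?thesis using is_distributive_lattice_iso[OF 2 Jpow_distributive] by simp
  next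
    case 4
    from iso antichains_e6[OF 4] show ?thesis by (rule is_distributive_lattice_Ak_empty)
  qed
qed

lemma Ak_J_J_J_2_3:
  assumes "poset_iso P (J (J (J (prod_poset (chain 2) (chain 3)))))"
  shows "poset_iso (Ak P 1) P" "poset_iso (Ak P 2) P" "is_singleton_poset (Ak P 3)"
    "is_distributive_lattice (Ak P k)"
proof -
  have iso: "poset_iso P (subposet (set e7))"
    using assms J_J_J_2_3_iso_e7 by (rule poset_iso_trans)
  show 1: "poset_iso (Ak P 1) P" using iso finite_set by (rule Ak_1_iso_subposet)
  have "poset_iso (Ak P 2) (subposet (set e7))"
    using Ak_cong[OF iso] Ak_2_e7_iso by (rule poset_iso_trans)
  then show 2: "poset_iso (Ak P 2) P" using poset_iso_sym[OF iso] by (rule poset_iso_trans)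
  show 3: "is_singleton_poset (Ak P 3)"
    by (rule is_singleton_poset_iso[OF Ak_cong[OF iso]])
      (simp add: is_singleton_poset_def antichains_k_3_e7)
  have P: "is_distributive_lattice P" using assms is_distributive_lattice_J by (rule is_distributive_lattice_iso)
  consider "k = 0" | "k = 1" | "k = 2" | "k = 3" | "k \<ge> 4" by linarith
  then show "is_distributive_lattice (Ak P k)"
  proof cases
    case 1
    then show ?thesis
      using is_distributive_lattice_Ak_singleton[OF is_singleton_poset_Ak_0] by simp
  next
    case 2
    then show ?thesis using is_distributive_lattice_iso[OF 1 P] by simp
  next
    case 3
    then show ?thesis using is_distributive_lattice_iso[OF 2 P] by simp
  next
    case 4
    then show ?thesis using is_distributive_lattice_Ak_singleton[OF 3] by simp
  next
    case 5
    then have "antichains_k (subposet (set e7)) k = {}"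
      using antichains_e7[of _ k] by force
    with iso show ?thesis by (rule is_distributive_lattice_Ak_empty)
  qed
qed

theorem theorem4p2:
  fixes P :: "'a poset" and k :: nat
  assumes "irreducible_minuscule P" and "k \<le> width P"
  shows
   "(\<forall>a b. a > 0 \<longrightarrow> b > 0 \<longrightarrow> poset_iso P (prod_poset (chain a) (chain b)) \<longrightarrow>
        poset_iso (Ak P k) (prod_poset (Cnk a k) (Cnk b k))) \<and>
    (\<forall>n. n > 0 \<longrightarrow> poset_iso P (J (prod_poset (chain n) (chain 2))) \<longrightarrow>
        poset_iso (Ak P k) (Ak (Cnk (n + 2) 2) k) \<and>
        poset_iso (Ak (Cnk (n + 2) 2) k) (Cnk (n + 2) (2 * k))) \<and>
    (\<forall>m. poset_iso P (Jpow m (prod_poset (chain 2) (chain 2))) \<longrightarrow>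
        ((k = 0 \<or> k = 2) \<longrightarrow> is_singleton_poset (Ak P k)) \<and>
        (k = 1 \<longrightarrow> poset_iso (Ak P k) P)) \<and>
    (poset_iso P (J (J (prod_poset (chain 2) (chain 3)))) \<longrightarrow>
        (k = 0 \<longrightarrow> is_singleton_poset (Ak P k)) \<and>
        (k = 1 \<longrightarrow> poset_iso (Ak P k) P) \<and>
        (k = 2 \<longrightarrow> poset_iso (Ak P k) (Jpow 3 (prod_poset (chain 2) (chain 2))))) \<and>
    (poset_iso P (J (J (J (prod_poset (chain 2) (chain 3))))) \<longrightarrow>
        ((k = 0 \<or> k = 3) \<longrightarrow> is_singleton_poset (Ak P k)) \<and>
        ((k = 1 \<or> k = 2) \<longrightarrow> poset_iso (Ak P k) P)) \<and>
    is_distributive_lattice (Ak P k)"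
\<comment> \<open>Splitting alternatives such as \<open>k = 0 \<or> k = 2\<close> leaves, besides
  the cases treated individually, only goals in which \<open>k\<close> is a fixed number.\<close>
proof (intro conjI allI impI; (elim conjE disjE)?)
  fix a b assume "poset_iso P (prod_poset (chain a) (chain b))"
  from Ak_prod_chain_iso[OF this] poset_iso_sym[OF prod_Cnk_iso_split_poset]
  show "poset_iso (Ak P k) (prod_poset (Cnk a k) (Cnk b k))" by (rule poset_iso_trans)
next
  fix n assume "poset_iso P (J (prod_poset (chain n) (chain 2)))"
  from Ak_J_prod_chain_2_iso[OF this] poset_iso_sym[OF Ak_Cnk_2_iso]
  show "poset_iso (Ak P k) (Ak (Cnk (n + 2) 2) k)" by (rule poset_iso_trans)
next
  fix n show "poset_iso (Ak (Cnk (n + 2) 2) k) (Cnk (n + 2) (2 * k))" by (rule Ak_Cnk_2_iso)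
next
  show "is_distributive_lattice (Ak P k)"
    using assms(1) unfolding irreducible_minuscule_def
  proof (elim disjE exE conjE)
    fix a b assume "poset_iso P (prod_poset (chain a) (chain b))"
    from Ak_prod_chain_iso[OF this] is_distributive_lattice_split_poset
    show ?thesis by (rule is_distributive_lattice_iso)
  next
    fix n assume "poset_iso P (J (prod_poset (chain n) (chain 2)))"
    from Ak_J_prod_chain_2_iso[OF this]
    have "poset_iso (Ak P k) (split_poset (n + 2) 0 (n + 2) k)" unfolding split_poset_eq_Cnk .
    then show ?thesis using is_distributive_lattice_split_poset by (rule is_distributive_lattice_iso)
  qed (rule Ak_Jpow_2_2 Ak_J_J_2_3 Ak_J_J_J_2_3, assumption)+
qed (simp_all only: is_singleton_poset_Ak_0 Ak_Jpow_2_2 Ak_J_J_2_3 Ak_J_J_J_2_3)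

end
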